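(* Let $\lambda>0$ be a constant, let $V(x)=\lambda|x|^2$ for $x\in\mathbb{R}^d$, and let $\mu$ be the probability measure $\mu(dx)=\dfrac{e^{-V(x)}\,dx}{\int_{\mathbb{R}^d}e^{-V(x)}\,dx}$ on $\mathbb{R}^d$. Then for any probability measure $\nu$ on $\mathbb{R}^d$ with $\int_{\mathbb{R}^d}e^{\lambda\theta|z|^2}\,\nu(dz)<\infty$ for some constant $\theta>1$, there exists a constant $C>0$ such that the log-Sobolev inequality $$(\mu*\nu)(f^2\log f^2)\le C\,(\mu*\nu)(|\nabla f|^2)$$ holds for all $f\in C_b^1(\mathbb{R}^d)$ with $(\mu*\nu)(f^2)=1$.
   Context: For a measure $m$ and a function $g$, $m(g):=\int g\,dm$. The convolution is $(\mu*\nu)(A)=\int 1_A(x+y)\,\mu(dx)\nu(dy)$. $C_b^1(\mathbb{R}^d)$ denotes the bounded $C^1$ functions on $\mathbb{R}^d$ with bounded gradient. *)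

theory Defs
  imports "HOL-Probability.Probability"
begin

text \<open>A non-differentiable point gives an unspecified value; the gradient is only used for
  differentiable functions.\<close>
definition gradient :: "('a::real_inner \<Rightarrow> real) \<Rightarrow> 'a \<Rightarrow> 'a"
  where "gradient f x = (THE D. GDERIV f x :> D)"

lemma gradient_eqI:
  assumes "GDERIV f x :> D"
  shows "gradient f x = D"
  unfolding gradient_def
proof (rule the_equality[where P = "\<lambda>D. GDERIV f x :> D", OF assms])
  fix E assume "GDERIV f x :> E"
  with assms have "(\<lambda>h. inner h E) = (\<lambda>h. inner h D)"
    unfolding gderiv_def by (rule has_derivative_unique[rotated])
  then have "inner (E - D) E = inner (E - D) D"
    by (rule fun_cong)
  then have "inner (E - D) (E - D) = 0"
    by (simp add: inner_diff_right)
  then show "E = D" by simp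
qed

definition Cb1 :: "('a::euclidean_space \<Rightarrow> real) set"
  where "Cb1 = {f. bounded (range f) \<and> (\<forall>x. f differentiable (at x)) \<and>
                   continuous_on UNIV (gradient f) \<and> bounded (range (gradient f))}"

definition gibbs_measure :: "('a::euclidean_space \<Rightarrow> real) \<Rightarrow> 'a measure"
  where "gibbs_measure V =
    density lborel (\<lambda>x. ennreal (exp (- V x) / (\<integral>y. exp (- V y) \<partial>lborel)))"

end

theory Submission
  imports Defs
begin

text \<open>
  Let \<open>Z\<close> have law \<open>\<nu>\<close>, let \<open>G\<close> be an independent Gaussian vector with density proportional to
  \<open>exp (- \<kappa> * norm x ^ 2)\<close>, and let \<open>X = Z + G\<close>, so that \<open>X\<close> has law \<open>\<mu> \<star> \<nu>\<close>.  The inequality follows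
  from a defective log-Sobolev inequality (one with an additional term \<open>B * E (f X ^ 2)\<close>) and a
  Poincare inequality.  The arguments work with the pair \<open>(X, Z)\<close>, since \<open>X\<close> is Gaussian
  conditionally on \<open>Z\<close>.

  The role of the condition \<open>\<theta> > 1\<close> is the moment bound \<open>second_moment_control\<close>: the weight \<open>norm X ^ 2\<close>
  under \<open>E (f X ^ 2 * _)\<close> costs only the energy and the mass of \<open>f\<close>.  Gaussian integration by parts,
  conditionally on \<open>Z\<close>, controls the weight \<open>norm (X - Z) ^ 2\<close>.  It remains to control \<open>norm Z ^ 2\<close>,
  and the exponential moment gives \<open>E (norm Z ^ 2 | X = x) \<le> a * norm x ^ 2 + K\<close> with
  \<open>a = 2 / (1 + \<theta>) < 1\<close>; the term in \<open>norm x ^ 2\<close> can then be absorbed on the left-hand side.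

  The defective inequality comes from smoothing.  For an independent copy \<open>Y\<close> of \<open>G\<close>, the point
  \<open>Z + cos t * G + sin t * Y\<close> can be joined to \<open>X = Z + G\<close> by rotating \<open>(G, Y)\<close>; rotations preserve
  the law of the pair, so \<open>f\<close> changes along this path by at most a constant times \<open>t ^ 2\<close> times the energy in mean
  square.  On the other hand, if \<open>E (f X ^ 2) \<le> 1\<close>, the average of \<open>f ^ 2\<close> over \<open>Y\<close> is at most \<open>t ^ (- d) * T\<close>, where
  \<open>T\<close> grows like an exponential of \<open>norm X ^ 2 + norm Z ^ 2\<close>.  Hence, where \<open>f X ^ 2\<close> exceeds a large
  multiple of this bound, it is controlled by the change of \<open>f\<close> along the rotation.  Summing over
  the dyadic angles \<open>t = 2 ^ (- k - 1)\<close> turns these level set estimates into a bound for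
  \<open>f X ^ 2 * ln (f X ^ 2 / T)\<close>, because a logarithm counts dyadic levels; the remaining term
  \<open>f X ^ 2 * ln T\<close> is covered by the moment bound.

  For the Poincare inequality the same rotation argument with \<open>t = pi / 2\<close> is applied to the Gaussian
  density proportional to \<open>exp (- 2 * \<kappa> * norm x ^ 2)\<close>, which up to constants is dominated by the density of
  \<open>X\<close> everywhere and dominates it on balls; the mass outside a large ball is absorbed by the moment bound.

  Finally, if the energy is bounded below, the additional term of the defective inequality is at most
  a multiple of the energy.  If the energy is small, then \<open>f\<close> is close to a constant \<open>c\<close> that is
  bounded away from zero; the entropy of \<open>f ^ 2\<close> is then of second order in \<open>g = f - c\<close> up to
  \<open>g ^ 2 * ln (1 + 4 * g ^ 2)\<close>, and both terms are bounded by the energy.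
\<close>

section \<open>Elementary inequalities\<close>

lemma le_one_plus_square: "t \<le> 1 + t\<^sup>2" for t :: real
proof -
  have "0 \<le> (t - 1)\<^sup>2 + t\<^sup>2"
    by simp
  then have "2 * t \<le> 1 + 2 * t\<^sup>2"
    by (simp add: power2_eq_square algebra_simps)
  then show ?thesis
    using zero_le_power2[of t] by linarith
qed

lemma norm_sq_add_le:
  fixes y z :: "'a::real_normed_vector"
  assumes "\<eta> > 0"
  shows "(norm (y + z))\<^sup>2 \<le> (1 + \<eta>) * (norm z)\<^sup>2 + (1 + 1 / \<eta>) * (norm y)\<^sup>2"
proof -
  have "(norm (y + z))\<^sup>2 \<le> (norm y + norm z)\<^sup>2"
    by (intro power_mono norm_triangle_ineq) simp
  also have "\<dots> \<le> (1 + \<eta>) * (norm z)\<^sup>2 + (1 + 1 / \<eta>) * (norm y)\<^sup>2"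
  proof -
    have "0 \<le> (\<eta> * norm z - norm y)\<^sup>2 / \<eta>"
      using assms by simp
    then show ?thesis
      using assms by (simp add: power2_eq_square field_simps)
  qed
  finally show ?thesis .
qed

lemma half_le_sin:
  fixes t :: real
  assumes "0 \<le> t" "t \<le> 1"
  shows "t / 2 \<le> sin t"
proof -
  have "\<bar>sin t - (\<Sum>m<2. sin_coeff m * t ^ m)\<bar> \<le> inverse (fact 2) * \<bar>t\<bar> ^ 2"
    by (rule Maclaurin_sin_bound)
  moreover have "(\<Sum>m<2. sin_coeff m * t ^ m) = t"
    by (simp add: numeral_2_eq_2 sin_coeff_def)
  ultimately have "\<bar>sin t - t\<bar> \<le> t\<^sup>2 / 2"
    by simp
  then have "t - t\<^sup>2 / 2 \<le> sin t"
    by linarith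
  moreover have "t\<^sup>2 \<le> t"
    using assms by (simp add: power2_eq_square mult_left_le)
  ultimately show ?thesis
    by linarith
qed

text \<open>
  A logarithm is at most the number of dyadic levels below its argument, up to a factor.  This replaces
  the layer cake integral of the logarithm by a sum over countably many levels.
\<close>

lemma dyadic_log_bound:
  fixes w :: real
  assumes "1 < w" "d > 0"
  obtains n where "ln w \<le> real n * (real d * ln 2)" "\<And>k. k < n \<Longrightarrow> 2 ^ (k * d) < w"
proof -
  obtain j where "w < 2 ^ j"
    using real_arch_pow[of 2 w] by auto
  also have "(2::real) ^ j \<le> 2 ^ (j * d)"
    using assms by (intro power_increasing) auto
  finally have ex: "\<exists>j. w \<le> 2 ^ (j * d)"
    by (intro exI[of _ j]) simp
  define n where "n = (LEAST j. w \<le> 2 ^ (j * d))"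
  have "w \<le> 2 ^ (n * d)"
    unfolding n_def by (rule LeastI_ex[OF ex])
  then have "ln w \<le> ln (2 ^ (n * d))"
    using assms by (subst ln_le_cancel_iff) auto
  then have "ln w \<le> real n * (real d * ln 2)"
    by (simp add: ln_realpow)
  moreover have "2 ^ (k * d) < w" if "k < n" for k
    using not_less_Least[OF that[unfolded n_def]] by simp
  ultimately show thesis
    by (rule that)
qed

text \<open>
  Near \<open>y = 1\<close> the function \<open>y * ln y - y + 1\<close> is at most \<open>(y - 1) ^ 2\<close>, since \<open>ln y \<le> y - 1\<close>; with
  \<open>y = (1 + u) ^ 2\<close> this is quadratic in \<open>u\<close>.  For \<open>\<bar>u\<bar> > 1\<close> one has \<open>y \<le> 4 * u ^ 2\<close>, and the growth
  \<open>u ^ 2 * ln (u ^ 2)\<close> appears.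
\<close>

lemma entropy_perturbation_unit:
  fixes u :: real
  shows "(1 + u)\<^sup>2 * ln ((1 + u)\<^sup>2) - (1 + u)\<^sup>2 + 1 \<le> 9 * u\<^sup>2 + 4 * u\<^sup>2 * ln (1 + u\<^sup>2)"
proof -
  define y where "y = (1 + u)\<^sup>2"
  have y: "y \<ge> 0"
    by (simp add: y_def)
  have nn: "0 \<le> 4 * u\<^sup>2 * ln (1 + u\<^sup>2)"
    by simp
  have "y * ln y - y + 1 \<le> 9 * u\<^sup>2 + 4 * u\<^sup>2 * ln (1 + u\<^sup>2)"
  proof (cases "\<bar>u\<bar> \<le> 1")
    case True
    have "y * ln y \<le> y * (y - 1)"
    proof (cases "y = 0")
      case False
      then show ?thesis
        using y by (intro mult_left_mono ln_le_minus_one) auto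
    qed simp
    then have "y * ln y - y + 1 \<le> (y - 1)\<^sup>2"
      by (simp add: power2_eq_square algebra_simps)
    also have "\<dots> = (2 + u)\<^sup>2 * u\<^sup>2"
      by (simp add: y_def power2_eq_square algebra_simps)
    also have "\<dots> \<le> 3\<^sup>2 * u\<^sup>2"
      using True by (intro mult_right_mono power_mono) auto
    also have "\<dots> = 9 * u\<^sup>2"
      by simp
    finally show ?thesis
      using nn by linarith
  next
    case False
    then have "1 \<le> \<bar>u\<bar>"
      by simp
    then have u1: "1 \<le> u\<^sup>2"
      using power_mono[of 1 "\<bar>u\<bar>" 2] by simp
    have y4: "y \<le> 4 * u\<^sup>2"
    proof -
      have "\<bar>1 + u\<bar> \<le> 2 * \<bar>u\<bar>"
        using \<open>1 \<le> \<bar>u\<bar>\<close> by linarith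
      then have "\<bar>1 + u\<bar>\<^sup>2 \<le> (2 * \<bar>u\<bar>)\<^sup>2"
        by (rule power_mono) simp
      then show ?thesis
        by (simp add: y_def power_mult_distrib)
    qed
    have ln4: "ln (4::real) \<le> 2"
    proof -
      have "ln (4::real) = ln 2 + ln 2"
        using ln_mult[of 2 "2::real"] by simp
      then show ?thesis
        using ln_le_minus_one[of "2::real"] by simp
    qed
    have "y * ln y \<le> 4 * u\<^sup>2 * (2 + ln (1 + u\<^sup>2))"
    proof (cases "1 \<le> y")
      case True
      have "ln y \<le> ln (4 * (1 + u\<^sup>2))"
        using True y4 by (subst ln_le_cancel_iff) (auto simp: add_pos_nonneg)
      also have "\<dots> = ln 4 + ln (1 + u\<^sup>2)"
        by (intro ln_mult_pos) (auto simp: add_pos_nonneg)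
      also have "\<dots> \<le> 2 + ln (1 + u\<^sup>2)"
        using ln4 by simp
      finally show ?thesis
        using True y4 by (intro mult_mono) auto
    next
      case False
      then have "ln y \<le> 0"
        using y by (cases "y = 0") auto
      then have "y * ln y \<le> 0"
        using y by (intro mult_nonneg_nonpos)
      also have "0 \<le> 4 * u\<^sup>2 * (2 + ln (1 + u\<^sup>2))"
        by simp
      finally show ?thesis .
    qed
    then have "y * ln y \<le> 8 * u\<^sup>2 + 4 * u\<^sup>2 * ln (1 + u\<^sup>2)"
      by (simp add: algebra_simps)
    then show ?thesis
      using u1 y by linarith
  qed
  then show ?thesis
    by (simp add: y_def)
qed

text \<open>
  The rescaled form of the preceding inequality, \<open>u = (a - c) / c\<close>.  For \<open>a = f X\<close> with
  \<open>E (f X ^ 2) = 1\<close> the last two terms have expectation \<open>1 + ln (c ^ 2) - c ^ 2 \<le> 0\<close>, so that only the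
  terms of second order in \<open>a - c\<close> survive.
\<close>

lemma entropy_perturbation:
  fixes a c :: real
  assumes "c\<^sup>2 \<ge> 1 / 4"
  shows "a\<^sup>2 * ln (a\<^sup>2) \<le> 9 * (a - c)\<^sup>2 + 4 * ((a - c)\<^sup>2 * ln (1 + 4 * (a - c)\<^sup>2)) + a\<^sup>2 * (1 + ln (c\<^sup>2)) - c\<^sup>2"
proof -
  have c: "c \<noteq> 0" "c\<^sup>2 > 0"
    using assms by auto
  define u where "u = (a - c) / c"
  have "a = c * (1 + u)"
    using c by (simp add: u_def field_simps)
  then have a: "a\<^sup>2 = c\<^sup>2 * (1 + u)\<^sup>2"
    by (simp only: power_mult_distrib)
  have d: "(a - c)\<^sup>2 = c\<^sup>2 * u\<^sup>2"
    using c by (simp add: u_def power_divide)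
  have "u\<^sup>2 \<le> 4 * (a - c)\<^sup>2"
    unfolding d using mult_right_mono[OF assms, of "u\<^sup>2"] by simp
  then have ln: "ln (1 + u\<^sup>2) \<le> ln (1 + 4 * (a - c)\<^sup>2)"
    by (subst ln_le_cancel_iff) (auto simp: add_pos_nonneg)
  have "c\<^sup>2 * ((1 + u)\<^sup>2 * ln ((1 + u)\<^sup>2) - (1 + u)\<^sup>2 + 1) \<le> c\<^sup>2 * (9 * u\<^sup>2 + 4 * u\<^sup>2 * ln (1 + u\<^sup>2))"
    by (intro mult_left_mono entropy_perturbation_unit) simp
  also have "\<dots> = 9 * (a - c)\<^sup>2 + 4 * ((a - c)\<^sup>2 * ln (1 + u\<^sup>2))"
    unfolding d by (simp add: algebra_simps)
  also have "\<dots> \<le> 9 * (a - c)\<^sup>2 + 4 * ((a - c)\<^sup>2 * ln (1 + 4 * (a - c)\<^sup>2))"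
    using ln by (simp add: mult_left_mono)
  finally have "a\<^sup>2 * ln ((1 + u)\<^sup>2) - a\<^sup>2 + c\<^sup>2 \<le> 9 * (a - c)\<^sup>2 + 4 * ((a - c)\<^sup>2 * ln (1 + 4 * (a - c)\<^sup>2))"
    unfolding a by (simp add: algebra_simps)
  moreover have "a\<^sup>2 * ln (a\<^sup>2) = a\<^sup>2 * ln ((1 + u)\<^sup>2) + a\<^sup>2 * ln (c\<^sup>2)"
  proof (cases "a = 0")
    case False
    then have "(1 + u)\<^sup>2 > 0"
      using a c by (metis mult_zero_right zero_less_power2 zero_eq_power2)
    then have "ln (a\<^sup>2) = ln (c\<^sup>2) + ln ((1 + u)\<^sup>2)"
      unfolding a using c by (intro ln_mult_pos) auto
    then show ?thesis
      by (simp add: distrib_left)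
  qed simp
  ultimately show ?thesis
    by (simp add: algebra_simps)
qed

lemma abs_mult_ln_le:
  fixes x :: real
  assumes "x \<ge> 0"
  shows "\<bar>x * ln x\<bar> \<le> 1 + x\<^sup>2"
proof (cases "x = 0")
  case False
  then have x: "x > 0"
    using assms by simp
  have "x * ln x \<le> x * (x - 1)"
    using x by (intro mult_left_mono ln_le_minus_one) auto
  moreover have "x * ln (1 / x) \<le> x * (1 / x - 1)"
    using x by (intro mult_left_mono ln_le_minus_one) auto
  then have "- (x * ln x) \<le> 1 - x"
    using x by (simp add: ln_div right_diff_distrib)
  ultimately show ?thesis
    using x by (simp add: abs_le_iff power2_eq_square right_diff_distrib) (smt (verit) x zero_le_square)
qed simp

text \<open>
  Used to choose the centring constant of the Poincare inequality as a value of the function itself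
  instead of its mean, so that the average over pairs of points can be used directly.
\<close>

lemma (in prob_space) nn_integral_attains_le:
  assumes [measurable]: "g \<in> borel_measurable M" and fin: "(\<integral>\<^sup>+x. g x \<partial>M) < \<infinity>"
  obtains x where "x \<in> space M" "g x \<le> (\<integral>\<^sup>+x. g x \<partial>M)"
proof (rule ccontr)
  let ?I = "\<integral>\<^sup>+x. g x \<partial>M"
  note attain = that
  assume "\<not> thesis"
  then have gt: "?I < g x" if "x \<in> space M" for x
    using attain[OF that] by (meson not_le_imp_less)
  have I: "(\<integral>\<^sup>+x. ?I \<partial>M) = ?I"
    using emeasure_space_1 by simp
  have "(\<integral>\<^sup>+x. g x - ?I \<partial>M) = ?I - (\<integral>\<^sup>+x. ?I \<partial>M)"
    using fin gt I by (intro nn_integral_diff) (auto intro!: AE_I2 less_imp_le simp: less_top)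
  also have "\<dots> = 0"
    unfolding I using fin by (simp add: diff_eq_0_iff_ennreal less_top)
  finally have ae: "AE x in M. g x - ?I = 0"
    by (subst (asm) nn_integral_0_iff_AE) auto
  have ne: "g x - ?I \<noteq> 0" if "x \<in> space M" for x
    using gt[OF that] by (simp add: diff_eq_0_iff_ennreal not_le)
  from ae AE_space have "AE x in M. False"
    by eventually_elim (use ne in auto)
  then show False
    by simp
qed

section \<open>The class of bounded differentiable test functions\<close>

lemma Cb1_GDERIV:
  assumes "f \<in> Cb1"
  shows "GDERIV f x :> gradient f x"
proof -
  obtain D where D: "(f has_derivative D) (at x)"
    using assms by (auto simp: Cb1_def differentiable_def)
  then interpret D: bounded_linear D
    by (rule has_derivative_bounded_linear)
  have "D = (\<lambda>h. h \<bullet> (\<Sum>b\<in>Basis. D b *\<^sub>R b))"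
  proof
    fix h
    have "D h = D (\<Sum>b\<in>Basis. (h \<bullet> b) *\<^sub>R b)"
      by (simp add: euclidean_representation)
    also have "\<dots> = h \<bullet> (\<Sum>b\<in>Basis. D b *\<^sub>R b)"
      by (simp add: D.sum D.scaleR inner_sum_right mult.commute)
    finally show "D h = h \<bullet> (\<Sum>b\<in>Basis. D b *\<^sub>R b)" .
  qed
  with D have "GDERIV f x :> (\<Sum>b\<in>Basis. D b *\<^sub>R b)"
    by (simp add: gderiv_def)
  then show ?thesis
    using gradient_eqI by metis
qed

lemma Cb1_I:
  assumes "\<And>x. GDERIV f x :> g x" "\<And>x. \<bar>f x\<bar> \<le> A" "\<And>x. norm (g x) \<le> B" "continuous_on UNIV g"
  shows "f \<in> Cb1"
proof -
  have "gradient f = g"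
    by (rule ext) (rule gradient_eqI[OF assms(1)])
  moreover have "f differentiable (at x)" for x
    using assms(1)[of x] by (auto simp: gderiv_def differentiable_def)
  ultimately show ?thesis
    using assms(2-4) by (auto simp: Cb1_def bounded_iff)
qed

lemma Cb1_bounds:
  assumes "f \<in> Cb1"
  obtains A where "A \<ge> 0" "\<And>x. \<bar>f x\<bar> \<le> A" "\<And>x. norm (gradient f x) \<le> A"
proof -
  obtain B where B: "\<And>x. \<bar>f x\<bar> \<le> B"
    using assms by (auto simp: Cb1_def bounded_iff)
  obtain C where C: "\<And>x. norm (gradient f x) \<le> C"
    using assms by (auto simp: Cb1_def bounded_iff)
  show thesis
  proof (rule that[of "max B C"])
    show "0 \<le> max B C"
      using B[of 0] by (auto simp: max_def)
    show "\<bar>f x\<bar> \<le> max B C" "norm (gradient f x) \<le> max B C" for x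
      using B[of x] C[of x] by auto
  qed
qed

lemma Cb1_continuous_gradient: "f \<in> Cb1 \<Longrightarrow> continuous_on UNIV (gradient f)"
  by (simp add: Cb1_def)

lemma Cb1_continuous: "f \<in> Cb1 \<Longrightarrow> continuous_on UNIV f"
  unfolding Cb1_def
  by (intro continuous_at_imp_continuous_on ballI differentiable_imp_continuous_within) simp

lemma Cb1_measurable: "f \<in> Cb1 \<Longrightarrow> f \<in> borel_measurable borel"
  by (intro borel_measurable_continuous_onI Cb1_continuous)

lemma Cb1_measurable_gradient: "f \<in> Cb1 \<Longrightarrow> gradient f \<in> borel_measurable borel"
  by (intro borel_measurable_continuous_onI Cb1_continuous_gradient)

lemma Cb1_translate:
  assumes "f \<in> Cb1"
  shows "(\<lambda>u. f (u + z)) \<in> Cb1" "gradient (\<lambda>u. f (u + z)) = (\<lambda>u. gradient f (u + z))"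
proof -
  obtain A where A: "A \<ge> 0" "\<And>x. \<bar>f x\<bar> \<le> A" "\<And>x. norm (gradient f x) \<le> A"
    by (rule Cb1_bounds[OF assms]) (rule that)
  have G: "GDERIV (\<lambda>u. f (u + z)) u :> gradient f (u + z)" for u
  proof -
    have "((\<lambda>u. u + z) has_derivative (\<lambda>h. h)) (at u)"
      by (auto intro!: derivative_eq_intros)
    from has_derivative_compose[OF this, of f] show ?thesis
      using Cb1_GDERIV[OF assms, of "u + z"] by (auto simp: gderiv_def)
  qed
  have "continuous_on UNIV (\<lambda>u. gradient f (u + z))"
    by (rule continuous_on_compose2[OF Cb1_continuous_gradient[OF assms]]) (auto intro!: continuous_intros)
  then show "(\<lambda>u. f (u + z)) \<in> Cb1"
    using A by (intro Cb1_I[OF G]) auto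
  show "gradient (\<lambda>u. f (u + z)) = (\<lambda>u. gradient f (u + z))"
    by (rule ext) (rule gradient_eqI[OF G])
qed

lemma Cb1_diff_const:
  assumes "f \<in> Cb1"
  shows "(\<lambda>u. f u - c) \<in> Cb1" "gradient (\<lambda>u. f u - c) = gradient f"
proof -
  obtain A where A: "A \<ge> 0" "\<And>x. \<bar>f x\<bar> \<le> A" "\<And>x. norm (gradient f x) \<le> A"
    by (rule Cb1_bounds[OF assms]) (rule that)
  have G: "GDERIV (\<lambda>u. f u - c) u :> gradient f u" for u
    using GDERIV_diff[OF Cb1_GDERIV[OF assms, of u] GDERIV_const[of c]] by simp
  have "\<bar>f x - c\<bar> \<le> A + \<bar>c\<bar>" for x
    using A(2)[of x] by linarith
  then show "(\<lambda>u. f u - c) \<in> Cb1"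
    using A by (intro Cb1_I[OF G _ _ Cb1_continuous_gradient[OF assms]]) auto
  show "gradient (\<lambda>u. f u - c) = gradient f"
    by (rule ext) (rule gradient_eqI[OF G])
qed

lemma DERIV_along_curve:
  assumes "f \<in> Cb1" "(c has_vector_derivative c') (at s)"
  shows "((\<lambda>s. f (c s)) has_real_derivative (c' \<bullet> gradient f (c s))) (at s)"
proof -
  have "(\<lambda>h. (h *\<^sub>R c') \<bullet> gradient f (c s)) = (*) (c' \<bullet> gradient f (c s))"
    by (auto simp: fun_eq_iff)
  then show ?thesis
    using has_derivative_compose[OF assms(2)[unfolded has_vector_derivative_def]
      Cb1_GDERIV[OF assms(1), of "c s", unfolded gderiv_def]]
    by (simp add: has_field_derivative_def)
qed

section \<open>Gaussian measures\<close>

lemma integrable_exp_neg_norm_sq: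
  assumes "\<kappa> > 0"
  shows "integrable lborel (\<lambda>x::'a::euclidean_space. exp (- (\<kappa> * (norm x)\<^sup>2)))"
proof (rule integrableI_nonneg)
  have one: "(\<integral>\<^sup>+t. ennreal (exp (- (\<kappa> * t\<^sup>2))) \<partial>lborel) < \<infinity>"
  proof -
    define \<sigma> where "\<sigma> = 1 / sqrt (2 * \<kappa>)"
    have \<sigma>: "\<sigma> > 0" "\<sigma>\<^sup>2 = 1 / (2 * \<kappa>)"
      using assms by (auto simp: \<sigma>_def power_divide)
    have "integrable lborel (\<lambda>t. sqrt (2 * pi * \<sigma>\<^sup>2) * normal_density 0 \<sigma> t)"
      using \<sigma> by (intro integrable_mult_right) simp
    moreover have "sqrt (2 * pi * \<sigma>\<^sup>2) * normal_density 0 \<sigma> t = exp (- (\<kappa> * t\<^sup>2))" for t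
      using assms \<sigma> by (simp add: normal_density_def field_simps)
    ultimately have "integrable lborel (\<lambda>t. exp (- (\<kappa> * t\<^sup>2)))"
      by simp
    then show ?thesis
      by (simp add: integrable_iff_bounded)
  qed
  have "(norm x)\<^sup>2 = (\<Sum>b\<in>Basis. (x \<bullet> b)\<^sup>2)" for x :: 'a
    unfolding power2_norm_eq_inner by (subst euclidean_inner) (simp add: power2_eq_square)
  then have "ennreal (exp (- (\<kappa> * (norm x)\<^sup>2))) = (\<Prod>b\<in>Basis. ennreal (exp (- (\<kappa> * (x \<bullet> b)\<^sup>2))))"
    for x :: 'a
    by (simp add: prod_ennreal sum_distrib_left sum_negf[symmetric] exp_sum)
  then have "(\<integral>\<^sup>+x. ennreal (exp (- (\<kappa> * (norm x)\<^sup>2))) \<partial>(lborel :: 'a measure))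
      = (\<integral>\<^sup>+x. (\<Prod>b\<in>Basis. ennreal (exp (- (\<kappa> * (x \<bullet> b)\<^sup>2)))) \<partial>(lborel :: 'a measure))"
    by simp
  also have "\<dots> = (\<Prod>b\<in>(Basis::'a set). \<integral>\<^sup>+t. ennreal (exp (- (\<kappa> * t\<^sup>2))) \<partial>lborel)"
    by (rule nn_integral_lborel_prod) auto
  also have "\<dots> < \<infinity>"
    using one by (simp add: power_less_top_ennreal less_top)
  finally show "(\<integral>\<^sup>+x. ennreal (exp (- (\<kappa> * (norm x)\<^sup>2))) \<partial>(lborel :: 'a measure)) < \<infinity>" .
qed auto

abbreviation gauss :: "real \<Rightarrow> 'a::euclidean_space measure"
  where "gauss \<kappa> \<equiv> gibbs_measure (\<lambda>x. \<kappa> * (norm x)\<^sup>2)"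

definition gauss_const :: "'a::euclidean_space itself \<Rightarrow> real \<Rightarrow> real"
  where "gauss_const _ \<kappa> = 1 / (\<integral>y. exp (- (\<kappa> * (norm y)\<^sup>2)) \<partial>(lborel :: 'a measure))"

lemma gauss_const_pos:
  assumes "\<kappa> > 0"
  shows "gauss_const TYPE('a::euclidean_space) \<kappa> > 0"
proof -
  let ?f = "\<lambda>y::'a. exp (- (\<kappa> * (norm y)\<^sup>2))"
  have "(\<integral>y. ?f y \<partial>lborel) \<ge> 0"
    by simp
  moreover have "(\<integral>y. ?f y \<partial>lborel) \<noteq> 0"
  proof
    assume "(\<integral>y. ?f y \<partial>lborel) = 0"
    then have "AE y in lborel. ?f y = 0"
      by (subst (asm) integral_nonneg_eq_0_iff_AE[OF integrable_exp_neg_norm_sq[OF assms]]) auto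
    then have "AE y in (lborel::'a measure). False"
      by eventually_elim (metis exp_not_eq_zero)
    then show False
      by (simp add: AE_iff_measurable[OF _ refl])
  qed
  ultimately have "(\<integral>y. ?f y \<partial>lborel) > 0"
    by linarith
  then show ?thesis
    by (simp add: gauss_const_def)
qed

lemma sets_gibbs_measure [simp, measurable_cong]: "sets (gibbs_measure V) = sets borel"
  and space_gibbs_measure [simp]: "space (gibbs_measure V) = UNIV"
  by (simp_all add: gibbs_measure_def)

lemma gauss_eq_density:
  "(gauss \<kappa> :: 'a::euclidean_space measure)
     = density lborel (\<lambda>x. ennreal (gauss_const TYPE('a) \<kappa> * exp (- (\<kappa> * (norm x)\<^sup>2))))"
  by (simp add: gibbs_measure_def gauss_const_def)

lemma nn_integral_gauss:
  fixes F :: "'a::euclidean_space \<Rightarrow> ennreal"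
  assumes [measurable]: "F \<in> borel_measurable borel"
  shows "(\<integral>\<^sup>+x. F x \<partial>gauss \<kappa>)
    = (\<integral>\<^sup>+x. ennreal (gauss_const TYPE('a) \<kappa> * exp (- (\<kappa> * (norm x)\<^sup>2))) * F x \<partial>lborel)"
  unfolding gauss_eq_density by (subst nn_integral_density) auto

lemma prob_space_gauss:
  assumes "\<kappa> > 0"
  shows "prob_space (gauss \<kappa> :: 'a::euclidean_space measure)"
proof
  let ?c = "gauss_const TYPE('a) \<kappa>"
  have "emeasure (gauss \<kappa> :: 'a measure) (space (gauss \<kappa>)) = (\<integral>\<^sup>+x. 1 \<partial>(gauss \<kappa> :: 'a measure))"
    by simp
  also have "\<dots> = (\<integral>\<^sup>+x. ennreal (?c * exp (- (\<kappa> * (norm x)\<^sup>2))) \<partial>(lborel :: 'a measure))"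
    by (subst nn_integral_gauss) auto
  also have "\<dots> = ennreal (\<integral>x. ?c * exp (- (\<kappa> * (norm x)\<^sup>2)) \<partial>(lborel :: 'a measure))"
    using gauss_const_pos[OF assms, where 'a='a] integrable_exp_neg_norm_sq[OF assms, where 'a='a]
    by (intro nn_integral_eq_integral) auto
  also have "\<dots> = 1"
    using gauss_const_pos[OF assms, where 'a='a] by (simp add: gauss_const_def)
  finally show "emeasure (gauss \<kappa> :: 'a measure) (space (gauss \<kappa>)) = 1" .
qed

lemma exp_neg_norm_sq_moment:
  fixes t \<kappa> :: real
  assumes "\<kappa> > 0" "t \<ge> 0"
  shows "t * exp (- (\<kappa> * t)) \<le> 2 / \<kappa> * exp (- (\<kappa> / 2 * t))"
proof -
  have "\<kappa> / 2 * t \<le> exp (\<kappa> / 2 * t)"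
    using exp_ge_add_one_self[of "\<kappa> / 2 * t"] by linarith
  then have "t \<le> 2 / \<kappa> * exp (\<kappa> / 2 * t)"
    using assms by (simp add: field_simps)
  then have "t * exp (- (\<kappa> * t)) \<le> 2 / \<kappa> * exp (\<kappa> / 2 * t) * exp (- (\<kappa> * t))"
    by (rule mult_right_mono) simp
  also have "\<dots> = 2 / \<kappa> * exp (- (\<kappa> / 2 * t))"
    by (simp add: exp_add[symmetric] mult.assoc)
  finally show ?thesis .
qed

lemma integrable_norm_sq_exp_neg_norm_sq:
  assumes "\<kappa> > 0"
  shows "integrable lborel (\<lambda>x::'a::euclidean_space. (norm x)\<^sup>2 * exp (- (\<kappa> * (norm x)\<^sup>2)))"
proof (rule Bochner_Integration.integrable_bound)
  show "integrable lborel (\<lambda>x::'a. 2 / \<kappa> * exp (- (\<kappa> / 2 * (norm x)\<^sup>2)))"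
    using assms by (intro integrable_mult_right integrable_exp_neg_norm_sq) simp
  show "AE x::'a in lborel. norm ((norm x)\<^sup>2 * exp (- (\<kappa> * (norm x)\<^sup>2)))
      \<le> norm (2 / \<kappa> * exp (- (\<kappa> / 2 * (norm x)\<^sup>2)))"
    using exp_neg_norm_sq_moment[OF assms] assms by (intro AE_I2) (simp add: abs_mult)
qed auto

lemma integrable_gauss_norm_sq:
  assumes "\<kappa> > 0"
  shows "integrable (gauss \<kappa>) (\<lambda>x::'a::euclidean_space. (norm x)\<^sup>2)"
  unfolding gauss_eq_density
  using gauss_const_pos[OF assms, where 'a='a] integrable_norm_sq_exp_neg_norm_sq[OF assms, where 'a='a]
  by (subst integrable_density) (auto simp: mult_ac)

definition gauss_variance :: "'a::euclidean_space itself \<Rightarrow> real \<Rightarrow> real"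
  where "gauss_variance _ \<kappa> = (\<integral>y. (norm y)\<^sup>2 \<partial>(gauss \<kappa> :: 'a measure))"

section \<open>Rotations of pairs of independent Gaussian vectors\<close>

lemma nn_integral_lborel_affine:
  fixes F :: "'a::euclidean_space \<Rightarrow> ennreal"
  assumes [measurable]: "F \<in> borel_measurable borel" and "s \<noteq> 0"
  shows "(\<integral>\<^sup>+x. F x \<partial>lborel) = ennreal (\<bar>s\<bar> ^ DIM('a)) * (\<integral>\<^sup>+x. F (t + s *\<^sub>R x) \<partial>lborel)"
  by (subst lborel_affine[OF assms(2), of t])
    (simp add: nn_integral_density nn_integral_distr nn_integral_cmult)

text \<open>
  For fixed \<open>x\<close> the substitution \<open>u = a * x + b * y\<close> in the inner integral has Jacobian \<open>\<bar>b\<bar> ^ d\<close>; for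
  fixed \<open>u\<close> the second coordinate is then an affine function of \<open>x\<close> with Jacobian \<open>\<bar>1 / b\<bar> ^ d\<close>.
  The two factors cancel.  The orientation of the second coordinate, \<open>a * y - b * x\<close>, makes it the
  derivative of the first one along the rotation.
\<close>

lemma nn_integral_lborel_rotate:
  fixes F :: "'a::euclidean_space \<Rightarrow> 'a \<Rightarrow> ennreal"
  assumes F [measurable]: "(\<lambda>p. F (fst p) (snd p)) \<in> borel_measurable (borel \<Otimes>\<^sub>M borel)"
    and ab: "a\<^sup>2 + b\<^sup>2 = 1" and b: "b \<noteq> 0"
  shows "(\<integral>\<^sup>+x. \<integral>\<^sup>+y. F (a *\<^sub>R x + b *\<^sub>R y) (a *\<^sub>R y - b *\<^sub>R x) \<partial>lborel \<partial>lborel)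
    = (\<integral>\<^sup>+x. \<integral>\<^sup>+y. F x y \<partial>lborel \<partial>lborel)"
proof -
  let ?D = "ennreal (\<bar>b\<bar> ^ DIM('a))" and ?D' = "ennreal (\<bar>- 1 / b\<bar> ^ DIM('a))"
  have DD: "?D * ?D' = 1" "?D' * ?D = 1"
    using b by (simp_all add: ennreal_mult[symmetric] power_divide)
  have Fm [measurable (raw)]: "(\<lambda>w. F (g w) (h w)) \<in> borel_measurable M"
    if "g \<in> borel_measurable M" "h \<in> borel_measurable M" for g h and M :: "'m measure"
    using measurable_compose[OF measurable_Pair[OF that] F] by simp
  have "(\<integral>\<^sup>+y. F (a *\<^sub>R x + b *\<^sub>R y) (a *\<^sub>R y - b *\<^sub>R x) \<partial>lborel)
      = ?D' * (\<integral>\<^sup>+u. F u ((a / b) *\<^sub>R u + (- 1 / b) *\<^sub>R x) \<partial>lborel)" (is "?l = ?D' * ?r") for x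
  proof -
    have "(a / b) *\<^sub>R (a *\<^sub>R x + b *\<^sub>R y) + (- 1 / b) *\<^sub>R x = a *\<^sub>R y - b *\<^sub>R x" for y
    proof -
      have "(a / b) *\<^sub>R (a *\<^sub>R x + b *\<^sub>R y) + (- 1 / b) *\<^sub>R x = a *\<^sub>R y - ((1 - a\<^sup>2) / b) *\<^sub>R x"
        using b by (simp add: algebra_simps diff_divide_distrib power2_eq_square)
      also have "(1 - a\<^sup>2) / b = b"
        using ab b by (simp add: field_simps power2_eq_square)
      finally show ?thesis .
    qed
    then have "?r = ?D * ?l"
      by (subst nn_integral_lborel_affine[OF _ b, of _ "a *\<^sub>R x"]) simp_all
    show ?thesis
      unfolding \<open>?r = ?D * ?l\<close> mult.assoc[symmetric] DD by simp
  qed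
  then have "(\<integral>\<^sup>+x. \<integral>\<^sup>+y. F (a *\<^sub>R x + b *\<^sub>R y) (a *\<^sub>R y - b *\<^sub>R x) \<partial>lborel \<partial>lborel)
      = (\<integral>\<^sup>+x. \<integral>\<^sup>+u. ?D' * F u ((a / b) *\<^sub>R u + (- 1 / b) *\<^sub>R x) \<partial>lborel \<partial>lborel)"
    by (simp add: nn_integral_cmult)
  also have "\<dots> = (\<integral>\<^sup>+u. \<integral>\<^sup>+x. ?D' * F u ((a / b) *\<^sub>R u + (- 1 / b) *\<^sub>R x) \<partial>lborel \<partial>lborel)"
    by (rule lborel_pair.Fubini') measurable
  also have "\<dots> = (\<integral>\<^sup>+u. \<integral>\<^sup>+v. F u v \<partial>lborel \<partial>lborel)"
  proof (rule nn_integral_cong)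
    fix u :: 'a
    have "(\<integral>\<^sup>+v. F u v \<partial>lborel) = ?D' * (\<integral>\<^sup>+x. F u ((a / b) *\<^sub>R u + (- 1 / b) *\<^sub>R x) \<partial>lborel)"
      using b by (intro nn_integral_lborel_affine) simp_all
    then show "(\<integral>\<^sup>+x. ?D' * F u ((a / b) *\<^sub>R u + (- 1 / b) *\<^sub>R x) \<partial>lborel) = (\<integral>\<^sup>+v. F u v \<partial>lborel)"
      by (simp add: nn_integral_cmult)
  qed
  finally show ?thesis .
qed

lemma nn_integral_gauss_rotate:
  fixes F :: "'a::euclidean_space \<Rightarrow> 'a \<Rightarrow> ennreal"
  assumes F [measurable]: "(\<lambda>p. F (fst p) (snd p)) \<in> borel_measurable (borel \<Otimes>\<^sub>M borel)"
    and ab: "a\<^sup>2 + b\<^sup>2 = 1" and b: "b \<noteq> 0" and \<kappa>: "\<kappa> > 0"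
  shows "(\<integral>\<^sup>+x. \<integral>\<^sup>+y. F (a *\<^sub>R x + b *\<^sub>R y) (a *\<^sub>R y - b *\<^sub>R x) \<partial>gauss \<kappa> \<partial>gauss \<kappa>)
    = (\<integral>\<^sup>+x. \<integral>\<^sup>+y. F x y \<partial>gauss \<kappa> \<partial>gauss \<kappa>)"
proof -
  interpret G: prob_space "gauss \<kappa> :: 'a measure"
    by (rule prob_space_gauss[OF \<kappa>])
  let ?g = "\<lambda>x::'a. ennreal (gauss_const TYPE('a) \<kappa> * exp (- (\<kappa> * (norm x)\<^sup>2)))"
  have Fm [measurable (raw)]: "(\<lambda>w. F (g w) (h w)) \<in> borel_measurable M"
    if "g \<in> borel_measurable M" "h \<in> borel_measurable M" for g h and M :: "'m measure"
    using measurable_compose[OF measurable_Pair[OF that] F] by simp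
  have dbl: "(\<integral>\<^sup>+x. \<integral>\<^sup>+y. H x y \<partial>gauss \<kappa> \<partial>gauss \<kappa>)
      = (\<integral>\<^sup>+x. \<integral>\<^sup>+y. ?g x * ?g y * H x y \<partial>lborel \<partial>lborel)"
    if [measurable]: "(\<lambda>p. H (fst p) (snd p)) \<in> borel_measurable (borel \<Otimes>\<^sub>M borel)"
    for H :: "'a \<Rightarrow> 'a \<Rightarrow> ennreal"
  proof -
    have Hm [measurable (raw)]: "(\<lambda>w. H (g w) (h w)) \<in> borel_measurable M"
      if "g \<in> borel_measurable M" "h \<in> borel_measurable M" for g h and M :: "'m measure"
      using measurable_compose[OF measurable_Pair[OF that]
          \<open>(\<lambda>p. H (fst p) (snd p)) \<in> borel_measurable (borel \<Otimes>\<^sub>M borel)\<close>] by simp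
    show ?thesis
      by (simp add: nn_integral_gauss nn_integral_cmult mult.assoc)
  qed
  have norms: "(norm (a *\<^sub>R x + b *\<^sub>R y))\<^sup>2 + (norm (a *\<^sub>R y - b *\<^sub>R x))\<^sup>2 = (norm x)\<^sup>2 + (norm y)\<^sup>2"
    for x y :: 'a
  proof -
    have "(norm (a *\<^sub>R x + b *\<^sub>R y))\<^sup>2 + (norm (a *\<^sub>R y - b *\<^sub>R x))\<^sup>2
        = (a\<^sup>2 + b\<^sup>2) * ((norm x)\<^sup>2 + (norm y)\<^sup>2)"
      unfolding power2_norm_eq_inner
      by (simp add: algebra_simps inner_commute power2_eq_square)
    then show ?thesis using ab by simp
  qed
  have gg: "?g (a *\<^sub>R x + b *\<^sub>R y) * ?g (a *\<^sub>R y - b *\<^sub>R x) = ?g x * ?g y" for x y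
  proof -
    have *: "exp (- (\<kappa> * (norm u)\<^sup>2)) * exp (- (\<kappa> * (norm v)\<^sup>2)) = exp (- (\<kappa> * ((norm u)\<^sup>2 + (norm v)\<^sup>2)))"
      for u v :: 'a by (simp add: exp_add[symmetric] algebra_simps)
    have **: "?g u * ?g v = ennreal ((gauss_const TYPE('a) \<kappa>)\<^sup>2 * exp (- (\<kappa> * ((norm u)\<^sup>2 + (norm v)\<^sup>2))))"
      for u v :: 'a
      using gauss_const_pos[OF \<kappa>, where 'a='a] *[of u v, symmetric]
      by (simp add: ennreal_mult[symmetric] power2_eq_square[of "gauss_const _ _"] mult_ac)
    show ?thesis unfolding ** norms ..
  qed
  have "(\<integral>\<^sup>+x. \<integral>\<^sup>+y. F (a *\<^sub>R x + b *\<^sub>R y) (a *\<^sub>R y - b *\<^sub>R x) \<partial>gauss \<kappa> \<partial>gauss \<kappa>)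
     = (\<integral>\<^sup>+x. \<integral>\<^sup>+y. ?g (a *\<^sub>R x + b *\<^sub>R y) * ?g (a *\<^sub>R y - b *\<^sub>R x) *
          F (a *\<^sub>R x + b *\<^sub>R y) (a *\<^sub>R y - b *\<^sub>R x) \<partial>lborel \<partial>lborel)"
    unfolding gg by (rule dbl) measurable
  also have "\<dots> = (\<integral>\<^sup>+x. \<integral>\<^sup>+y. ?g x * ?g y * F x y \<partial>lborel \<partial>lborel)"
    using nn_integral_lborel_rotate[OF _ ab b, of "\<lambda>x y. ?g x * ?g y * F x y"] by simp
  also have "\<dots> = (\<integral>\<^sup>+x. \<integral>\<^sup>+y. F x y \<partial>gauss \<kappa> \<partial>gauss \<kappa>)"
    by (rule dbl[symmetric]) measurable
  finally show ?thesis .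
qed

text \<open>
  The Cauchy-Schwarz inequality for the integral of the derivative, written with a nonnegative integral
  on the right so that Tonelli's theorem applies to it.  With \<open>c\<close> the mean slope, it follows from
  integrating \<open>2 * c * \<phi> - c ^ 2 \<le> \<phi> ^ 2\<close>.
\<close>

lemma increment_squared_le:
  fixes F \<phi> :: "real \<Rightarrow> real"
  assumes deriv: "\<And>s. (F has_real_derivative \<phi> s) (at s)" and cont: "continuous_on UNIV \<phi>"
    and "0 \<le> \<theta>"
  shows "ennreal ((F \<theta> - F 0)\<^sup>2)
    \<le> ennreal \<theta> * (\<integral>\<^sup>+s. ennreal ((\<phi> s)\<^sup>2) * indicator {0..\<theta>} s \<partial>lborel)"
proof (cases "\<theta> = 0")
  case False
  with \<open>0 \<le> \<theta>\<close> have \<theta>: "\<theta> > 0" by simp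
  define I where "I = F \<theta> - F 0"
  define c where "c = I / \<theta>"
  have c1: "continuous_on {0..\<theta>} \<phi>" and c2: "continuous_on {0..\<theta>} (\<lambda>s. (\<phi> s)\<^sup>2)"
    using cont by (auto intro!: continuous_intros intro: continuous_on_subset)
  have i1: "integrable lborel (\<lambda>s. indicator {0..\<theta>} s * \<phi> s)"
    and i2: "integrable lborel (\<lambda>s. indicator {0..\<theta>} s * (\<phi> s)\<^sup>2)"
    using borel_integrable_atLeastAtMost'[OF c1] borel_integrable_atLeastAtMost'[OF c2]
    by (simp_all add: set_integrable_def)
  have v1: "(\<integral>s. indicator {0..\<theta>} s * \<phi> s \<partial>lborel) = I"
    using integral_FTC_atLeastAtMost[OF \<open>0 \<le> \<theta>\<close> _ c1, of F] deriv
    by (simp add: I_def has_real_derivative_iff_has_vector_derivative has_vector_derivative_at_within)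
  have i0: "integrable lborel (\<lambda>s. indicator {0..\<theta>} s :: real)"
    using \<theta> by (simp add: integrable_indicator_iff)
  have "I\<^sup>2 / \<theta> = 2 * c * I - c\<^sup>2 * \<theta>"
    using \<theta> by (simp add: c_def field_simps power2_eq_square)
  also have "\<dots> = (\<integral>s. 2 * c * (indicator {0..\<theta>} s * \<phi> s) - c\<^sup>2 * indicator {0..\<theta>} s \<partial>lborel)"
    using i1 i0 v1 \<theta> by simp
  also have "\<dots> \<le> (\<integral>s. indicator {0..\<theta>} s * (\<phi> s)\<^sup>2 \<partial>lborel)"
  proof (rule integral_mono)
    fix s
    have "0 \<le> (\<phi> s - c)\<^sup>2" by simp
    then show "2 * c * (indicator {0..\<theta>} s * \<phi> s) - c\<^sup>2 * indicator {0..\<theta>} s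
        \<le> indicator {0..\<theta>} s * (\<phi> s)\<^sup>2"
      by (auto simp: indicator_def power2_diff algebra_simps)
  qed (use i0 i1 i2 in auto)
  finally have "I\<^sup>2 \<le> \<theta> * (\<integral>s. indicator {0..\<theta>} s * (\<phi> s)\<^sup>2 \<partial>lborel)"
    using \<theta> by (simp add: field_simps)
  then have "ennreal (I\<^sup>2) \<le> ennreal \<theta> * ennreal (\<integral>s. indicator {0..\<theta>} s * (\<phi> s)\<^sup>2 \<partial>lborel)"
    using \<theta> by (simp add: ennreal_mult'[symmetric] ennreal_leI)
  also have "ennreal (\<integral>s. indicator {0..\<theta>} s * (\<phi> s)\<^sup>2 \<partial>lborel)
      = (\<integral>\<^sup>+s. ennreal (indicator {0..\<theta>} s * (\<phi> s)\<^sup>2) \<partial>lborel)"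
    using i2 by (intro nn_integral_eq_integral[symmetric]) auto
  also have "\<dots> = (\<integral>\<^sup>+s. ennreal ((\<phi> s)\<^sup>2) * indicator {0..\<theta>} s \<partial>lborel)"
    by (intro nn_integral_cong) (auto simp: indicator_def)
  finally show ?thesis
    by (simp add: I_def)
qed simp

text \<open>
  The point \<open>cos \<theta> * x + sin \<theta> * y\<close> is reached from \<open>x\<close> along a path of rotations.  At each time the
  position and the velocity on this path are again independent Gaussian vectors, so the mean square
  of the derivative of \<open>f\<close> along the path does not depend on time and factorises.
\<close>

lemma gauss_rotation_energy:
  fixes f :: "'a::euclidean_space \<Rightarrow> real"
  assumes f: "f \<in> Cb1" and \<kappa>: "\<kappa> > 0" and \<theta>: "0 \<le> \<theta>" "\<theta> < pi"
  shows "(\<integral>\<^sup>+x. \<integral>\<^sup>+y. ennreal ((f x - f (cos \<theta> *\<^sub>R x + sin \<theta> *\<^sub>R y))\<^sup>2) \<partial>gauss \<kappa> \<partial>gauss \<kappa>)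
    \<le> ennreal (\<theta>\<^sup>2) * ((\<integral>\<^sup>+x. ennreal ((norm (gradient f x))\<^sup>2) \<partial>gauss \<kappa>)
        * (\<integral>\<^sup>+y. ennreal ((norm (y::'a))\<^sup>2) \<partial>gauss \<kappa>))" (is "_ \<le> _ * (?D * ?S)")
proof -
  interpret G: prob_space "gauss \<kappa> :: 'a measure"
    by (rule prob_space_gauss[OF \<kappa>])
  interpret GL: pair_sigma_finite "gauss \<kappa> :: 'a measure" "lborel :: real measure" ..
  note [measurable] = Cb1_measurable[OF f] Cb1_measurable_gradient[OF f]
  have [measurable]: "(cos :: real \<Rightarrow> real) \<in> borel_measurable borel" "(sin :: real \<Rightarrow> real) \<in> borel_measurable borel"
    by (auto intro!: borel_measurable_continuous_onI continuous_intros)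
  define c where "c s x y = cos s *\<^sub>R x + sin s *\<^sub>R y" for s and x y :: 'a
  define c' where "c' s x y = cos s *\<^sub>R y - sin s *\<^sub>R x" for s and x y :: 'a
  have c_meas [measurable (raw)]: "(\<lambda>w. c (a w) (g w) (h w)) \<in> borel_measurable M"
    "(\<lambda>w. c' (a w) (g w) (h w)) \<in> borel_measurable M"
    if "a \<in> borel_measurable M" "g \<in> borel_measurable M" "h \<in> borel_measurable M"
    for a g h and M :: "'m measure"
    using that unfolding c_def c'_def by measurable
  let ?E = "\<lambda>s x y. ennreal ((norm (gradient f (c s x y)))\<^sup>2) * ennreal ((norm (c' s x y))\<^sup>2)
    * indicator {0..\<theta>} s"
  have "ennreal ((f x - f (c \<theta> x y))\<^sup>2) \<le> ennreal \<theta> * (\<integral>\<^sup>+s. ?E s x y \<partial>lborel)" for x y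
  proof -
    have "((\<lambda>s. c s x y) has_vector_derivative c' s x y) (at s)" for s
      unfolding c_def c'_def by (auto intro!: derivative_eq_intros)
    note DERIV_along_curve[OF f this]
    moreover have "continuous_on UNIV (\<lambda>s. c' s x y \<bullet> gradient f (c s x y))"
      unfolding c_def c'_def
      by (auto intro!: continuous_intros continuous_on_compose2[OF Cb1_continuous_gradient[OF f]])
    ultimately have "ennreal ((f (c \<theta> x y) - f (c 0 x y))\<^sup>2) \<le> ennreal \<theta> *
        (\<integral>\<^sup>+s. ennreal ((c' s x y \<bullet> gradient f (c s x y))\<^sup>2) * indicator {0..\<theta>} s \<partial>lborel)"
      by (rule increment_squared_le) (rule \<theta>)
    also have "\<dots> \<le> ennreal \<theta> * (\<integral>\<^sup>+s. ?E s x y \<partial>lborel)"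
    proof (intro mult_left_mono nn_integral_mono mult_right_mono)
      fix s
      have "(c' s x y \<bullet> gradient f (c s x y))\<^sup>2 \<le> (norm (gradient f (c s x y)))\<^sup>2 * (norm (c' s x y))\<^sup>2"
        using power_mono[OF Cauchy_Schwarz_ineq2[of "c' s x y" "gradient f (c s x y)"] abs_ge_zero, of 2]
        by (simp add: power_mult_distrib mult.commute)
      then show "ennreal ((c' s x y \<bullet> gradient f (c s x y))\<^sup>2)
          \<le> ennreal ((norm (gradient f (c s x y)))\<^sup>2) * ennreal ((norm (c' s x y))\<^sup>2)"
        by (simp add: ennreal_mult[symmetric] ennreal_leI)
    qed auto
    finally show ?thesis
      by (simp add: c_def power2_commute)
  qed
  then have "(\<integral>\<^sup>+x. \<integral>\<^sup>+y. ennreal ((f x - f (c \<theta> x y))\<^sup>2) \<partial>gauss \<kappa> \<partial>gauss \<kappa>)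
      \<le> (\<integral>\<^sup>+x. \<integral>\<^sup>+y. ennreal \<theta> * (\<integral>\<^sup>+s. ?E s x y \<partial>lborel) \<partial>gauss \<kappa> \<partial>gauss \<kappa>)"
    by (intro nn_integral_mono)
  also have "\<dots> = ennreal \<theta> * (\<integral>\<^sup>+x. \<integral>\<^sup>+y. \<integral>\<^sup>+s. ?E s x y \<partial>lborel \<partial>gauss \<kappa> \<partial>gauss \<kappa>)"
    by (simp add: nn_integral_cmult)
  also have "(\<integral>\<^sup>+x. \<integral>\<^sup>+y. \<integral>\<^sup>+s. ?E s x y \<partial>lborel \<partial>gauss \<kappa> \<partial>gauss \<kappa>)
      = (\<integral>\<^sup>+x. \<integral>\<^sup>+s. \<integral>\<^sup>+y. ?E s x y \<partial>gauss \<kappa> \<partial>lborel \<partial>gauss \<kappa>)"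
    by (intro nn_integral_cong GL.Fubini'[symmetric]) measurable
  also have "\<dots> = (\<integral>\<^sup>+s. \<integral>\<^sup>+x. \<integral>\<^sup>+y. ?E s x y \<partial>gauss \<kappa> \<partial>gauss \<kappa> \<partial>lborel)"
    by (rule GL.Fubini'[symmetric]) measurable
  also have "\<dots> = (\<integral>\<^sup>+s. ?D * ?S * indicator {0..\<theta>} s \<partial>lborel)"
  proof (rule nn_integral_cong)
    fix s :: real
    have "(\<integral>\<^sup>+x. \<integral>\<^sup>+y. ennreal ((norm (gradient f (c s x y)))\<^sup>2) * ennreal ((norm (c' s x y))\<^sup>2)
        \<partial>gauss \<kappa> \<partial>gauss \<kappa>) = ?D * ?S" if "s \<in> {0..\<theta>}"
    proof -
      have DS: "(\<integral>\<^sup>+x. \<integral>\<^sup>+y. ennreal ((norm (gradient f x))\<^sup>2) * ennreal ((norm (y::'a))\<^sup>2)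
          \<partial>gauss \<kappa> \<partial>gauss \<kappa>) = ?D * ?S"
        by (simp add: nn_integral_cmult nn_integral_multc)
      show ?thesis
      proof (cases "s = 0")
        case True
        then show ?thesis using DS by (simp add: c_def c'_def)
      next
        case False
        with that \<theta> have "sin s \<noteq> 0"
          using sin_gt_zero[of s] by auto
        then show ?thesis
          unfolding c_def c'_def
          using nn_integral_gauss_rotate[of "\<lambda>x y. ennreal ((norm (gradient f x))\<^sup>2) * ennreal ((norm y)\<^sup>2)"
              "cos s" "sin s" \<kappa>] DS \<kappa>
          by simp
      qed
    qed
    then show "(\<integral>\<^sup>+x. \<integral>\<^sup>+y. ?E s x y \<partial>gauss \<kappa> \<partial>gauss \<kappa>) = ?D * ?S * indicator {0..\<theta>} s"
      by (cases "s \<in> {0..\<theta>}") auto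
  qed
  also have "\<dots> = ennreal \<theta> * (?D * ?S)"
    using \<theta> by (subst nn_integral_cmult_indicator) (simp_all add: mult.commute)
  finally show ?thesis
    using \<theta> by (simp add: c_def power2_eq_square ennreal_mult mult.assoc)
qed

section \<open>Gaussian integration by parts\<close>

lemma integral_lborel_scale:
  fixes g :: "'a::euclidean_space \<Rightarrow> real"
  assumes [measurable]: "g \<in> borel_measurable borel" and "s > 0"
  shows "(\<integral>x. s ^ DIM('a) * g (s *\<^sub>R x) \<partial>lborel) = (\<integral>x. g x \<partial>lborel)"
proof -
  have "(\<integral>x. g x \<partial>lborel)
      = (\<integral>x. g x \<partial>density (distr lborel borel (\<lambda>x. 0 + s *\<^sub>R x)) (\<lambda>_. ennreal (\<bar>s\<bar> ^ DIM('a))))"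
    using lborel_affine[of s "0::'a"] \<open>s > 0\<close> by simp
  also have "\<dots> = (\<integral>x. \<bar>s\<bar> ^ DIM('a) *\<^sub>R g x \<partial>distr lborel borel (\<lambda>x. 0 + s *\<^sub>R x))"
    by (rule integral_density) auto
  also have "\<dots> = (\<integral>x. \<bar>s\<bar> ^ DIM('a) *\<^sub>R g (0 + s *\<^sub>R x) \<partial>lborel)"
    by (rule integral_distr) auto
  finally show ?thesis
    using \<open>s > 0\<close> by simp
qed

lemma integral_gauss:
  fixes g :: "'a::euclidean_space \<Rightarrow> real"
  assumes [measurable]: "g \<in> borel_measurable borel" and "\<kappa> > 0"
  shows "(\<integral>x. g x \<partial>gauss \<kappa>)
    = gauss_const TYPE('a) \<kappa> * (\<integral>x. exp (- (\<kappa> * (norm x)\<^sup>2)) * g x \<partial>lborel)"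
  unfolding gauss_eq_density
  using gauss_const_pos[OF assms(2), where 'a='a]
  by (subst integral_density) (auto simp: mult.assoc)

text \<open>
  The divergence theorem for the radial vector field, obtained without boundary terms: the integral of
  \<open>s ^ d * F (s * x)\<close> does not depend on the dilation factor \<open>s\<close>, so its derivative at \<open>s = 1\<close> vanishes.
  Here \<open>F\<close> is \<open>f ^ 2\<close> times the Gaussian density.
\<close>

lemma gauss_integral_by_parts:
  fixes f :: "'a::euclidean_space \<Rightarrow> real"
  assumes f: "f \<in> Cb1" and \<kappa>: "\<kappa> > 0"
  shows "(\<integral>x. real DIM('a) * (f x)\<^sup>2 + 2 * f x * (x \<bullet> gradient f x)
    - 2 * \<kappa> * ((norm x)\<^sup>2 * (f x)\<^sup>2) \<partial>gauss \<kappa>) = 0"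
proof -
  note [measurable] = Cb1_measurable[OF f] Cb1_measurable_gradient[OF f]
  obtain A where A: "A \<ge> 0" "\<And>x. \<bar>f x\<bar> \<le> A" "\<And>x. norm (gradient f x) \<le> A"
    by (rule Cb1_bounds[OF f]) (rule that)
  let ?d = "DIM('a)"
  define H where "H x s = s ^ ?d * ((f (s *\<^sub>R x))\<^sup>2 * exp (- (\<kappa> * (s\<^sup>2 * (norm x)\<^sup>2))))" for x :: 'a and s :: real
  define H' where "H' x s = (?d * s ^ (?d - 1) * (f (s *\<^sub>R x))\<^sup>2
      + s ^ ?d * (2 * f (s *\<^sub>R x) * (x \<bullet> gradient f (s *\<^sub>R x)))
      - s ^ ?d * (2 * \<kappa> * s * (norm x)\<^sup>2 * (f (s *\<^sub>R x))\<^sup>2)) * exp (- (\<kappa> * (s\<^sup>2 * (norm x)\<^sup>2)))"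
    for x :: 'a and s :: real
  have H': "(H x has_real_derivative H' x s) (at s)" for x s
  proof -
    have "((\<lambda>s. s *\<^sub>R x) has_vector_derivative x) (at s)"
      by (auto intro!: derivative_eq_intros)
    note D = DERIV_along_curve[OF f this]
    have "((\<lambda>s. s ^ ?d * ((f (s *\<^sub>R x))\<^sup>2 * exp (- (\<kappa> * (s\<^sup>2 * (norm x)\<^sup>2))))) has_real_derivative H' x s) (at s)"
      by (rule derivative_eq_intros D refl)+
        (simp add: H'_def power_mult_distrib power2_eq_square algebra_simps)
    then show ?thesis
      unfolding H_def .
  qed
  define M where "M = 2 ^ ?d * A\<^sup>2 * (?d + 2 + 4 * \<kappa>)"
  \<comment> \<open>an integrable bound for the derivative in the dilation parameter on [1, 2]\<close>
  define B where "B x = M * (exp (- (\<kappa> * (norm x)\<^sup>2)) + (norm x)\<^sup>2 * exp (- (\<kappa> * (norm x)\<^sup>2)))" for x :: 'a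
  have B: "integrable lborel B"
    unfolding B_def using \<kappa>
    by (intro integrable_mult_right Bochner_Integration.integrable_add
        integrable_exp_neg_norm_sq integrable_norm_sq_exp_neg_norm_sq)
  have bound: "\<bar>H' x s\<bar> \<le> B x" if s: "1 \<le> s" "s \<le> 2" for x s
  proof -
    have s0: "s ^ ?d \<le> 2 ^ ?d" "s ^ (?d - 1) \<le> 2 ^ ?d" "0 \<le> s ^ ?d" "0 \<le> s ^ (?d - 1)"
      using s power_mono[of s 2 ?d] power_mono[of s 2 "?d - 1"] power_increasing[of "?d - 1" ?d "2::real"]
      by (auto intro: order_trans)
    have fA: "(f (s *\<^sub>R x))\<^sup>2 \<le> A\<^sup>2"
      using A(1) A(2)[of "s *\<^sub>R x"] by (simp add: abs_le_square_iff[symmetric])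
    have nx: "norm x \<le> 1 + (norm x)\<^sup>2"
      by (rule le_one_plus_square)
    have fg: "\<bar>f (s *\<^sub>R x) * (x \<bullet> gradient f (s *\<^sub>R x))\<bar> \<le> A\<^sup>2 * (1 + (norm x)\<^sup>2)"
    proof -
      have "\<bar>x \<bullet> gradient f (s *\<^sub>R x)\<bar> \<le> norm x * norm (gradient f (s *\<^sub>R x))"
        by (rule Cauchy_Schwarz_ineq2)
      also have "\<dots> \<le> (1 + (norm x)\<^sup>2) * A"
        using nx A by (intro mult_mono) auto
      finally have "\<bar>f (s *\<^sub>R x)\<bar> * \<bar>x \<bullet> gradient f (s *\<^sub>R x)\<bar> \<le> A * ((1 + (norm x)\<^sup>2) * A)"
        using A by (intro mult_mono) auto
      then show ?thesis
        by (simp add: abs_mult power2_eq_square mult_ac)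
    qed
    have t1: "\<bar>?d * s ^ (?d - 1) * (f (s *\<^sub>R x))\<^sup>2\<bar> \<le> ?d * 2 ^ ?d * (A\<^sup>2 * (1 + (norm x)\<^sup>2))"
    proof -
      have "?d * s ^ (?d - 1) * (f (s *\<^sub>R x))\<^sup>2 \<le> ?d * 2 ^ ?d * (A\<^sup>2 * (1 + (norm x)\<^sup>2))"
        using s0 fA mult_mono[of 1 "1 + (norm x)\<^sup>2" "(f (s *\<^sub>R x))\<^sup>2" "A\<^sup>2"]
        by (intro mult_mono) (auto simp: mult.commute)
      then show ?thesis using s0 by (simp add: abs_mult)
    qed
    have t2: "\<bar>s ^ ?d * (2 * f (s *\<^sub>R x) * (x \<bullet> gradient f (s *\<^sub>R x)))\<bar> \<le> 2 ^ ?d * (2 * (A\<^sup>2 * (1 + (norm x)\<^sup>2)))"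
    proof -
      have "s ^ ?d * (2 * \<bar>f (s *\<^sub>R x) * (x \<bullet> gradient f (s *\<^sub>R x))\<bar>) \<le> 2 ^ ?d * (2 * (A\<^sup>2 * (1 + (norm x)\<^sup>2)))"
        using s0 fg by (intro mult_mono) auto
      then show ?thesis using s0 by (simp add: abs_mult mult.assoc)
    qed
    have t3: "\<bar>s ^ ?d * (2 * \<kappa> * s * (norm x)\<^sup>2 * (f (s *\<^sub>R x))\<^sup>2)\<bar> \<le> 2 ^ ?d * (4 * \<kappa> * (A\<^sup>2 * (1 + (norm x)\<^sup>2)))"
    proof -
      have a1: "2 * \<kappa> * s \<le> 4 * \<kappa>"
        using s \<kappa> by simp
      have a2: "(norm x)\<^sup>2 * (f (s *\<^sub>R x))\<^sup>2 \<le> (1 + (norm x)\<^sup>2) * A\<^sup>2"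
        using fA by (rule mult_mono[rotated]) auto
      have "(2 * \<kappa> * s) * ((norm x)\<^sup>2 * (f (s *\<^sub>R x))\<^sup>2) \<le> (4 * \<kappa>) * ((1 + (norm x)\<^sup>2) * A\<^sup>2)"
        by (rule mult_mono[OF a1 a2]) (use \<kappa> in auto)
      from mult_mono[OF s0(1) this]
      have "s ^ ?d * ((2 * \<kappa> * s) * ((norm x)\<^sup>2 * (f (s *\<^sub>R x))\<^sup>2)) \<le> 2 ^ ?d * ((4 * \<kappa>) * ((1 + (norm x)\<^sup>2) * A\<^sup>2))"
        using \<kappa> s by simp
      then show ?thesis using s0 \<kappa> s by (simp add: abs_mult mult_ac)
    qed
    have e: "exp (- (\<kappa> * (s\<^sup>2 * (norm x)\<^sup>2))) \<le> exp (- (\<kappa> * (norm x)\<^sup>2))"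
    proof -
      have "1 * (norm x)\<^sup>2 \<le> s\<^sup>2 * (norm x)\<^sup>2"
        using s by (intro mult_right_mono) (auto simp: one_le_power)
      then show ?thesis using \<kappa> by simp
    qed
    have "\<bar>?d * s ^ (?d - 1) * (f (s *\<^sub>R x))\<^sup>2
      + s ^ ?d * (2 * f (s *\<^sub>R x) * (x \<bullet> gradient f (s *\<^sub>R x)))
      - s ^ ?d * (2 * \<kappa> * s * (norm x)\<^sup>2 * (f (s *\<^sub>R x))\<^sup>2)\<bar> \<le> M * (1 + (norm x)\<^sup>2)"
      using t1 t2 t3 unfolding M_def by (simp add: algebra_simps)
    moreover have "M \<ge> 0"
      using \<kappa> by (simp add: M_def)
    ultimately have "\<bar>?d * s ^ (?d - 1) * (f (s *\<^sub>R x))\<^sup>2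
      + s ^ ?d * (2 * f (s *\<^sub>R x) * (x \<bullet> gradient f (s *\<^sub>R x)))
      - s ^ ?d * (2 * \<kappa> * s * (norm x)\<^sup>2 * (f (s *\<^sub>R x))\<^sup>2)\<bar> * exp (- (\<kappa> * (s\<^sup>2 * (norm x)\<^sup>2)))
      \<le> M * (1 + (norm x)\<^sup>2) * exp (- (\<kappa> * (norm x)\<^sup>2))"
      by (metis (no_types, lifting) mult_mono e abs_ge_zero exp_ge_zero mult_nonneg_nonneg add_nonneg_nonneg zero_le_power2 zero_le_one)
    also have "\<dots> = B x"
      by (simp add: B_def algebra_simps)
    finally show ?thesis
      unfolding H'_def abs_mult[of _ "exp _"] abs_exp_cancel .
  qed
  define q where "q n x = (H x (1 + 1 / real (Suc n)) - H x 1) * real (Suc n)" for n x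
  have Hm [measurable]: "(\<lambda>x. H x s) \<in> borel_measurable borel" for s
    unfolding H_def by measurable
  have H'm [measurable]: "(\<lambda>x. H' x s) \<in> borel_measurable borel" for s
    unfolding H'_def by measurable
  have qB: "\<bar>q n x\<bar> \<le> B x" for n x
  proof -
    obtain \<xi> where "1 < \<xi>" "\<xi> < 1 + 1 / real (Suc n)"
      "H x (1 + 1 / real (Suc n)) - H x 1 = (1 + 1 / real (Suc n) - 1) * H' x \<xi>"
      using MVT2[of 1 "1 + 1 / real (Suc n)" "H x" "H' x"] H' by (auto simp del: of_nat_Suc)
    then have "q n x = H' x \<xi>" "1 \<le> \<xi>" "\<xi> \<le> 1 + 1 / real (Suc n)"
      by (simp_all add: q_def del: of_nat_Suc)
    moreover have "1 / real (Suc n) \<le> 1"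
      by simp
    then have "\<xi> \<le> 2"
      using \<open>\<xi> \<le> 1 + 1 / real (Suc n)\<close> by linarith
    ultimately show ?thesis
      using bound[of \<xi> x] by simp
  qed
  have qlim: "(\<lambda>n. q n x) \<longlonglongrightarrow> H' x 1" for x
  proof -
    have "((\<lambda>h. (H x (1 + h) - H x 1) / h) \<longlongrightarrow> H' x 1) (at 0)"
      using H'[of x 1] by (simp add: DERIV_def)
    moreover have "filterlim (\<lambda>n. 1 / real (Suc n)) (at 0) sequentially"
      using LIMSEQ_Suc[OF lim_1_over_n] by (simp add: filterlim_at del: of_nat_Suc)
    ultimately have "(\<lambda>n. (H x (1 + 1 / real (Suc n)) - H x 1) / (1 / real (Suc n))) \<longlonglongrightarrow> H' x 1"
      by (rule filterlim_compose)
    then show ?thesis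
      by (simp add: q_def)
  qed
  have qm [measurable]: "(\<lambda>x. q n x) \<in> borel_measurable borel" for n
    unfolding q_def by measurable
  have qint: "integrable lborel (q n)" for n
  proof (rule Bochner_Integration.integrable_bound[OF B])
    show "q n \<in> borel_measurable lborel"
      using qm[of n] by simp
    show "AE x in lborel. norm (q n x) \<le> norm (B x)"
      using order_trans[OF qB abs_ge_self] by (intro AE_I2) simp
  qed
  have Hint: "integrable lborel (\<lambda>x. H x 1)"
  proof (rule Bochner_Integration.integrable_bound)
    show "integrable lborel (\<lambda>x::'a. A\<^sup>2 * exp (- (\<kappa> * (norm x)\<^sup>2)))"
      by (intro integrable_mult_right integrable_exp_neg_norm_sq \<kappa>)
    show "AE x in lborel. norm (H x 1) \<le> norm (A\<^sup>2 * exp (- (\<kappa> * (norm x)\<^sup>2)))"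
      using A by (intro AE_I2) (auto simp: H_def abs_le_square_iff[symmetric])
  qed simp
  have q0: "(\<integral>x. q n x \<partial>lborel) = 0" for n
  proof -
    let ?s = "1 + 1 / real (Suc n)"
    have "?s > 0" by (simp add: add_pos_pos)
    have "integrable lborel (\<lambda>x. q n x * (1 / real (Suc n)) + H x 1)"
      by (intro Bochner_Integration.integrable_add integrable_mult_left qint Hint)
    then have Hs: "integrable lborel (\<lambda>x. H x ?s)"
      by (simp add: q_def del: of_nat_Suc)
    have "(\<integral>x. H x ?s \<partial>lborel) = (\<integral>x. H x 1 \<partial>lborel)"
      unfolding H_def
      using integral_lborel_scale[of "\<lambda>x. (f x)\<^sup>2 * exp (- (\<kappa> * (norm x)\<^sup>2))" ?s] \<open>?s > 0\<close>
      by (simp add: power_mult_distrib)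
    then show ?thesis
      using Hs Hint by (simp add: q_def)
  qed
  have "(\<lambda>n. \<integral>x. q n x \<partial>lborel) \<longlonglongrightarrow> (\<integral>x. H' x 1 \<partial>lborel)"
    by (rule integral_dominated_convergence[OF _ _ B])
      (use qlim qB in \<open>auto simp: q_def\<close>)
  then have "(\<integral>x. H' x 1 \<partial>lborel) = 0"
    by (simp add: q0 LIMSEQ_const_iff)
  then show ?thesis
    using \<kappa> by (subst integral_gauss) (auto simp: H'_def mult_ac)
qed

text \<open>
  The cross term of the integration by parts formula is split by the inequality between arithmetic and
  geometric means, so that half of the weighted term is absorbed.
\<close>

lemma gauss_weighted_moment:
  fixes f :: "'a::euclidean_space \<Rightarrow> real"
  assumes f: "f \<in> Cb1" and \<kappa>: "\<kappa> > 0"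
  shows "\<kappa> * (\<integral>x. (f x)\<^sup>2 * (norm x)\<^sup>2 \<partial>gauss \<kappa>)
    \<le> real DIM('a) * (\<integral>x. (f x)\<^sup>2 \<partial>gauss \<kappa>) + (\<integral>x. (norm (gradient f x))\<^sup>2 \<partial>gauss \<kappa>) / \<kappa>"
proof -
  interpret G: prob_space "gauss \<kappa> :: 'a measure"
    by (rule prob_space_gauss[OF \<kappa>])
  note [measurable] = Cb1_measurable[OF f] Cb1_measurable_gradient[OF f]
  obtain A where A: "A \<ge> 0" "\<And>x. \<bar>f x\<bar> \<le> A" "\<And>x. norm (gradient f x) \<le> A"
    by (rule Cb1_bounds[OF f]) (rule that)
  have fA: "(f x)\<^sup>2 \<le> A\<^sup>2" "(norm (gradient f x))\<^sup>2 \<le> A\<^sup>2" for x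
    using A(1) A(2)[of x] A(3)[of x] by (auto simp: abs_le_square_iff[symmetric])
  have i1: "integrable (gauss \<kappa>) (\<lambda>x. (f x)\<^sup>2)"
    and i2: "integrable (gauss \<kappa>) (\<lambda>x. (norm (gradient f x))\<^sup>2)"
    using fA by (auto intro!: G.integrable_const_bound[where B = "A\<^sup>2"] AE_I2)
  have i3: "integrable (gauss \<kappa>) (\<lambda>x. (f x)\<^sup>2 * (norm x)\<^sup>2)"
  proof (rule Bochner_Integration.integrable_bound)
    show "integrable (gauss \<kappa>) (\<lambda>x::'a. A\<^sup>2 * (norm x)\<^sup>2)"
      by (intro integrable_mult_right integrable_gauss_norm_sq \<kappa>)
    show "AE x in gauss \<kappa>. norm ((f x)\<^sup>2 * (norm x)\<^sup>2) \<le> norm (A\<^sup>2 * (norm x)\<^sup>2)"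
      using fA by (intro AE_I2) (auto intro!: mult_right_mono simp: abs_mult)
  qed simp
  have pw: "real DIM('a) * (f x)\<^sup>2 + 2 * f x * (x \<bullet> gradient f x) - 2 * \<kappa> * ((norm x)\<^sup>2 * (f x)\<^sup>2)
      \<le> real DIM('a) * (f x)\<^sup>2 + (norm (gradient f x))\<^sup>2 / \<kappa> - \<kappa> * ((f x)\<^sup>2 * (norm x)\<^sup>2)" for x
  proof -
    have "2 * f x * (x \<bullet> gradient f x) \<le> 2 * (\<bar>f x\<bar> * norm x) * norm (gradient f x)"
    proof -
      have "f x * (x \<bullet> gradient f x) \<le> \<bar>f x\<bar> * \<bar>x \<bullet> gradient f x\<bar>"
        by (simp add: abs_mult[symmetric])
      also have "\<dots> \<le> \<bar>f x\<bar> * (norm x * norm (gradient f x))"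
        by (intro mult_left_mono Cauchy_Schwarz_ineq2) simp
      finally show ?thesis
        by simp
    qed
    moreover have "0 \<le> (\<kappa> * (\<bar>f x\<bar> * norm x) - norm (gradient f x))\<^sup>2 / \<kappa>"
      using \<kappa> by simp
    then have "2 * (\<bar>f x\<bar> * norm x) * norm (gradient f x) \<le> \<kappa> * ((f x)\<^sup>2 * (norm x)\<^sup>2) + (norm (gradient f x))\<^sup>2 / \<kappa>"
      using \<kappa> by (simp add: power2_diff power_mult_distrib field_simps power2_eq_square)
    ultimately show ?thesis
      by (simp add: algebra_simps)
  qed
  define R where "R = (\<lambda>x. real DIM('a) * (f x)\<^sup>2 + (norm (gradient f x))\<^sup>2 / \<kappa> - \<kappa> * ((f x)\<^sup>2 * (norm x)\<^sup>2))"
  have R: "integrable (gauss \<kappa>) R"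
    unfolding R_def using i1 i2 i3
    by (intro Bochner_Integration.integrable_diff Bochner_Integration.integrable_add
        integrable_mult_right integrable_divide) auto
  have i4: "integrable (gauss \<kappa>) (\<lambda>x. f x * (x \<bullet> gradient f x))"
  proof (rule Bochner_Integration.integrable_bound)
    show "integrable (gauss \<kappa>) (\<lambda>x::'a. A\<^sup>2 * (1 + (norm x)\<^sup>2))"
      using integrable_gauss_norm_sq[OF \<kappa>, where 'a='a] by simp
    show "AE x in gauss \<kappa>. norm (f x * (x \<bullet> gradient f x)) \<le> norm (A\<^sup>2 * (1 + (norm x)\<^sup>2))"
    proof (rule AE_I2)
      fix x :: 'a
      have nx: "norm x \<le> 1 + (norm x)\<^sup>2"
        by (rule le_one_plus_square)
      have "\<bar>x \<bullet> gradient f x\<bar> \<le> (1 + (norm x)\<^sup>2) * A"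
        using order_trans[OF Cauchy_Schwarz_ineq2 mult_mono[OF nx A(3)]] by simp
      then have "\<bar>f x\<bar> * \<bar>x \<bullet> gradient f x\<bar> \<le> A * ((1 + (norm x)\<^sup>2) * A)"
        using A by (intro mult_mono) auto
      then show "norm (f x * (x \<bullet> gradient f x)) \<le> norm (A\<^sup>2 * (1 + (norm x)\<^sup>2))"
        by (simp add: abs_mult power2_eq_square mult_ac)
    qed
  qed simp
  have "integrable (gauss \<kappa>) (\<lambda>x. real DIM('a) * (f x)\<^sup>2 + 2 * (f x * (x \<bullet> gradient f x))
      - 2 * \<kappa> * ((f x)\<^sup>2 * (norm x)\<^sup>2))"
    by (intro Bochner_Integration.integrable_diff Bochner_Integration.integrable_add
        integrable_mult_right i1 i3 i4)
  then have "integrable (gauss \<kappa>) (\<lambda>x. real DIM('a) * (f x)\<^sup>2 + 2 * f x * (x \<bullet> gradient f x)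
      - 2 * \<kappa> * ((norm x)\<^sup>2 * (f x)\<^sup>2))"
    by (simp add: mult.assoc mult.commute[of "(norm _)\<^sup>2"])
  from integral_mono[OF this R] have "0 \<le> (\<integral>x. R x \<partial>gauss \<kappa>)"
    using gauss_integral_by_parts[OF f \<kappa>] by (simp add: R_def pw)
  also have "(\<integral>x. R x \<partial>gauss \<kappa>) = real DIM('a) * (\<integral>x. (f x)\<^sup>2 \<partial>gauss \<kappa>)
      + (\<integral>x. (norm (gradient f x))\<^sup>2 \<partial>gauss \<kappa>) / \<kappa> - \<kappa> * (\<integral>x. (f x)\<^sup>2 * (norm x)\<^sup>2 \<partial>gauss \<kappa>)"
    unfolding R_def using i1 i2 i3 by simp
  finally show ?thesis
    by simp
qed

section \<open>The mixture and its posterior distributions\<close>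

text \<open>
  The mixing variable \<open>Z\<close> has law \<open>\<nu>\<close>, and the mixture is \<open>X = Z + G\<close> with \<open>G\<close> Gaussian.
\<close>

locale gaussian_mixture =
  fixes \<kappa> \<theta> :: real and \<nu> :: "'a::euclidean_space measure"
  assumes \<kappa>: "\<kappa> > 0" and \<theta>: "\<theta> > 1"
    and prob_\<nu>: "prob_space \<nu>" and sets_\<nu> [simp, measurable_cong]: "sets \<nu> = sets borel"
    and moment: "(\<integral>\<^sup>+ z. ennreal (exp (\<kappa> * \<theta> * (norm z)\<^sup>2)) \<partial>\<nu>) < \<infinity>"
begin

sublocale N: prob_space \<nu>
  by (rule prob_\<nu>)

sublocale G: prob_space "gauss \<kappa> :: 'a measure"
  by (rule prob_space_gauss[OF \<kappa>])

sublocale NG: pair_prob_space \<nu> "gauss \<kappa> :: 'a measure" ..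

sublocale NL: pair_sigma_finite \<nu> "lborel :: 'a measure" ..

lemma space_\<nu> [simp]: "space \<nu> = UNIV"
  using sets_eq_imp_space_eq[OF sets_\<nu>] by simp

lemma integrable_exp_moment: "integrable \<nu> (\<lambda>z. exp (\<kappa> * \<theta> * (norm z)\<^sup>2))"
  using moment by (intro integrableI_nonneg) auto

lemma integrable_norm_sq: "integrable \<nu> (\<lambda>z. (norm z)\<^sup>2)"
proof (rule Bochner_Integration.integrable_bound)
  show "integrable \<nu> (\<lambda>z. 1 / (\<kappa> * \<theta>) * exp (\<kappa> * \<theta> * (norm z)\<^sup>2))"
    by (intro integrable_mult_right integrable_exp_moment)
  show "AE z in \<nu>. norm ((norm z)\<^sup>2) \<le> norm (1 / (\<kappa> * \<theta>) * exp (\<kappa> * \<theta> * (norm z)\<^sup>2))"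
  proof (rule AE_I2)
    fix z :: 'a
    have "\<kappa> * \<theta> * (norm z)\<^sup>2 \<le> exp (\<kappa> * \<theta> * (norm z)\<^sup>2)"
      using exp_ge_add_one_self[of "\<kappa> * \<theta> * (norm z)\<^sup>2"] by linarith
    then show "norm ((norm z)\<^sup>2) \<le> norm (1 / (\<kappa> * \<theta>) * exp (\<kappa> * \<theta> * (norm z)\<^sup>2))"
      using \<kappa> \<theta> by (simp add: field_simps)
  qed
qed simp

text \<open>
  The density of the mixture with respect to Lebesgue measure, up to the factor \<open>gauss_const\<close>.
\<close>

definition q :: "'a \<Rightarrow> real"
  where "q x = (\<integral>z. exp (- (\<kappa> * (norm (x - z))\<^sup>2)) \<partial>\<nu>)"

lemma integrable_kernel: "integrable \<nu> (\<lambda>z. exp (- (\<kappa> * (norm (x - z))\<^sup>2)))"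
  using \<kappa> by (intro N.integrable_const_bound[where B = 1]) auto

lemma q_le_1: "q x \<le> 1"
  unfolding q_def using \<kappa> N.prob_space
  by (intro order_trans[OF integral_mono[OF integrable_kernel, of "\<lambda>_. 1"]]) auto

text \<open>
  By the triangle inequality, \<open>norm (x - z) ^ 2\<close> is at most \<open>(1 + \<epsilon>) * norm x ^ 2\<close> plus a multiple of
  \<open>norm z ^ 2\<close>, so the kernel is bounded below by a product of a function of \<open>x\<close> and a strictly positive
  function of \<open>z\<close>.  The constant \<open>c\<close> is the integral of the latter.
\<close>

lemma q_lower_bound:
  assumes "\<epsilon> > 0"
  obtains c where "c > 0" "\<And>x. c * exp (- ((1 + \<epsilon>) * \<kappa> * (norm x)\<^sup>2)) \<le> q x"
proof
  define c where "c = (\<integral>z. exp (- ((1 + 1 / \<epsilon>) * \<kappa> * (norm z)\<^sup>2)) \<partial>\<nu>)"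
  have int: "integrable \<nu> (\<lambda>z. exp (- ((1 + 1 / \<epsilon>) * \<kappa> * (norm z)\<^sup>2)))"
    using \<kappa> assms by (intro N.integrable_const_bound[where B = 1]) auto
  have "c \<noteq> 0"
  proof
    assume "c = 0"
    then have "AE z in \<nu>. exp (- ((1 + 1 / \<epsilon>) * \<kappa> * (norm z)\<^sup>2)) = 0"
      unfolding c_def by (subst (asm) integral_nonneg_eq_0_iff_AE[OF int]) auto
    then show False
      using N.AE_False by simp
  qed
  moreover have "c \<ge> 0"
    by (simp add: c_def)
  ultimately show "c > 0"
    by simp
  show "c * exp (- ((1 + \<epsilon>) * \<kappa> * (norm x)\<^sup>2)) \<le> q x" for x
  proof -
    have "c * exp (- ((1 + \<epsilon>) * \<kappa> * (norm x)\<^sup>2))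
        = (\<integral>z. exp (- ((1 + 1 / \<epsilon>) * \<kappa> * (norm z)\<^sup>2)) * exp (- ((1 + \<epsilon>) * \<kappa> * (norm x)\<^sup>2)) \<partial>\<nu>)"
      by (simp add: c_def)
    also have "\<dots> \<le> q x"
      unfolding q_def
    proof (intro integral_mono integrable_kernel integrable_mult_left int)
      fix z
      have "(norm (x - z))\<^sup>2 \<le> (1 + \<epsilon>) * (norm x)\<^sup>2 + (1 + 1 / \<epsilon>) * (norm z)\<^sup>2"
        using norm_sq_add_le[OF assms, of "- z" x] by simp
      then have "\<kappa> * (norm (x - z))\<^sup>2 \<le> \<kappa> * ((1 + \<epsilon>) * (norm x)\<^sup>2 + (1 + 1 / \<epsilon>) * (norm z)\<^sup>2)"
        using \<kappa> by simp
      then show "exp (- ((1 + 1 / \<epsilon>) * \<kappa> * (norm z)\<^sup>2)) * exp (- ((1 + \<epsilon>) * \<kappa> * (norm x)\<^sup>2))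
          \<le> exp (- (\<kappa> * (norm (x - z))\<^sup>2))"
        by (simp add: exp_add[symmetric] algebra_simps)
    qed
    finally show ?thesis .
  qed
qed

lemma q_pos: "q x > 0"
proof -
  obtain c where "c > 0" "\<And>x. c * exp (- ((1 + 1) * \<kappa> * (norm x)\<^sup>2)) \<le> q x"
    by (rule q_lower_bound[of 1]) auto
  then show ?thesis
    by (meson exp_gt_zero less_le_trans mult_pos_pos)
qed

lemma integrable_norm_sq_kernel: "integrable \<nu> (\<lambda>z. (norm z)\<^sup>2 * exp (- (\<kappa> * (norm (x - z))\<^sup>2)))"
  using \<kappa> by (intro Bochner_Integration.integrable_bound[OF integrable_norm_sq])
    (auto intro!: AE_I2 mult_left_le)

text \<open>
  Dividing by \<open>q x\<close>, this bounds the second moment of \<open>Z\<close> given \<open>X = x\<close>; what matters is that \<open>a\<close> is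
  smaller than 1, and this is where \<open>\<theta> > 1\<close> enters.  The linearised entropy inequality
  \<open>v \<le> exp v / T + ln T - 1\<close> is used with \<open>v = s * norm z ^ 2\<close>.  With \<open>s = \<kappa> * (1 + \<theta>) / 2\<close>,
  completing the square consumes exactly the available exponential moment of \<open>\<nu>\<close>, and \<open>T\<close> is chosen such
  that the exponential term is at most \<open>q x\<close> by the lower bound with \<open>\<epsilon> = 1 - a\<close>.  Then
  \<open>ln T / s\<close> is \<open>a * norm x ^ 2\<close> plus a constant.
\<close>

lemma posterior_second_moment:
  obtains a K where "0 < a" "a < 1" "0 \<le> K"
    "\<And>x. (\<integral>z. (norm z)\<^sup>2 * exp (- (\<kappa> * (norm (x - z))\<^sup>2)) \<partial>\<nu>) \<le> (a * (norm x)\<^sup>2 + K) * q x"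
proof -
  define a where "a = 2 / (1 + \<theta>)"
  have a: "0 < a" "a < 1"
    using \<theta> by (auto simp: a_def field_simps)
  define s where "s = \<kappa> / a"
  have s: "s > 0" "s = \<kappa> * (1 + \<theta>) / 2" "\<kappa> * a = \<kappa>\<^sup>2 / s"
    using \<kappa> a by (auto simp: s_def a_def power2_eq_square)
  obtain c where c: "c > 0" "\<And>x. c * exp (- ((1 + (1 - a)) * \<kappa> * (norm x)\<^sup>2)) \<le> q x"
    using a by (elim q_lower_bound[of "1 - a", rotated]) auto
  define M where "M = (\<integral>z. exp (\<kappa> * \<theta> * (norm z)\<^sup>2) \<partial>\<nu>)"
  have "1 \<le> M"
  proof -
    have "1 = (\<integral>z. (1::real) \<partial>\<nu>)"
      using N.prob_space by simp
    also have "\<dots> \<le> M"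
      unfolding M_def using \<kappa> \<theta> by (intro integral_mono integrable_exp_moment) auto
    finally show ?thesis .
  qed
  define K where "K = \<bar>ln (M / c)\<bar> / s"
  show thesis
  proof (rule that[of a K])
    show "0 \<le> K"
      using s by (simp add: K_def)
    fix x :: 'a
    let ?W = "\<lambda>z. exp (- (\<kappa> * (norm (x - z))\<^sup>2))"
    define T where "T = M / c * exp (\<kappa> * (norm x)\<^sup>2)"
    have T: "T > 0"
      using c \<open>1 \<le> M\<close> by (simp add: T_def)
    have lnT: "ln T = ln (M / c) + \<kappa> * (norm x)\<^sup>2"
      using c \<open>1 \<le> M\<close> unfolding T_def by (subst ln_mult) auto
    define b where "b = exp (- (\<kappa> * (norm x)\<^sup>2) + \<kappa> * a * (norm x)\<^sup>2)"
    have pw: "s * ((norm z)\<^sup>2 * ?W z) \<le> b / T * exp (\<kappa> * \<theta> * (norm z)\<^sup>2) + (ln T - 1) * ?W z" for z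
    proof -
      have "1 + (s * (norm z)\<^sup>2 - ln T) \<le> exp (s * (norm z)\<^sup>2 - ln T)"
        by (rule exp_ge_add_one_self)
      then have "s * (norm z)\<^sup>2 \<le> exp (s * (norm z)\<^sup>2) / T + (ln T - 1)"
        using T by (simp add: exp_diff)
      then have "s * (norm z)\<^sup>2 * ?W z \<le> (exp (s * (norm z)\<^sup>2) / T + (ln T - 1)) * ?W z"
        by (rule mult_right_mono) simp
      also have "\<dots> = exp (s * (norm z)\<^sup>2) * ?W z / T + (ln T - 1) * ?W z"
        by (simp add: field_simps)
      also have "exp (s * (norm z)\<^sup>2) * ?W z \<le> b * exp (\<kappa> * \<theta> * (norm z)\<^sup>2)"
      proof -
        have "2 * \<kappa> * (x \<bullet> z) \<le> 2 * \<kappa> * (norm x * norm z)"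
          using \<kappa> norm_cauchy_schwarz[of x z] by simp
        also have "\<dots> \<le> \<kappa> * a * (norm x)\<^sup>2 + s * (norm z)\<^sup>2"
        proof -
          have "0 \<le> (\<kappa> * norm x - s * norm z)\<^sup>2 / s"
            using s by simp
          also have "\<dots> = \<kappa>\<^sup>2 / s * (norm x)\<^sup>2 + s * (norm z)\<^sup>2 - 2 * \<kappa> * (norm x * norm z)"
            using s(1) by (simp add: power2_eq_square field_simps)
          finally show ?thesis
            unfolding s(3) by linarith
        qed
        finally have "s * (norm z)\<^sup>2 - \<kappa> * ((norm x)\<^sup>2 - 2 * (x \<bullet> z) + (norm z)\<^sup>2)
            \<le> - (\<kappa> * (norm x)\<^sup>2) + \<kappa> * a * (norm x)\<^sup>2 + (2 * s - \<kappa>) * (norm z)\<^sup>2"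
          by (simp add: algebra_simps)
        also have "2 * s - \<kappa> = \<kappa> * \<theta>"
          using s(2) by (simp add: algebra_simps)
        also have "(norm x)\<^sup>2 - 2 * (x \<bullet> z) + (norm z)\<^sup>2 = (norm (x - z))\<^sup>2"
          by (simp add: power2_norm_eq_inner inner_diff_left inner_diff_right inner_commute)
        finally show ?thesis
          by (simp add: b_def exp_add[symmetric])
      qed
      finally show ?thesis
        using T by (simp add: field_simps divide_right_mono)
    qed
    have "s * (\<integral>z. (norm z)\<^sup>2 * ?W z \<partial>\<nu>) = (\<integral>z. s * ((norm z)\<^sup>2 * ?W z) \<partial>\<nu>)"
      by simp
    also have "\<dots> \<le> (\<integral>z. b / T * exp (\<kappa> * \<theta> * (norm z)\<^sup>2) + (ln T - 1) * ?W z \<partial>\<nu>)"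
      by (intro integral_mono pw integrable_mult_right integrable_norm_sq_kernel
          Bochner_Integration.integrable_add integrable_exp_moment integrable_kernel)
    also have "\<dots> = b / T * M + (ln T - 1) * q x"
      using integrable_exp_moment integrable_kernel[of x] by (simp add: M_def q_def)
    also have "b / T * M = c * exp (- ((1 + (1 - a)) * \<kappa> * (norm x)\<^sup>2))"
    proof -
      have "b / T * M = c * (b / exp (\<kappa> * (norm x)\<^sup>2))"
        using c \<open>1 \<le> M\<close> by (simp add: T_def)
      also have "b / exp (\<kappa> * (norm x)\<^sup>2) = exp (- ((1 + (1 - a)) * \<kappa> * (norm x)\<^sup>2))"
        unfolding b_def exp_diff[symmetric] by (simp add: algebra_simps)
      finally show ?thesis .
    qed
    also have "\<dots> \<le> q x"
      by (rule c)
    finally have "s * (\<integral>z. (norm z)\<^sup>2 * ?W z \<partial>\<nu>) \<le> ln T * q x"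
      by (simp add: algebra_simps)
    also have "\<dots> \<le> (s * K + s * a * (norm x)\<^sup>2) * q x"
    proof (rule mult_right_mono)
      have "s * K = \<bar>ln (M / c)\<bar>" "s * a = \<kappa>"
        using s(1) a \<kappa> by (simp_all add: K_def s_def)
      then show "ln T \<le> s * K + s * a * (norm x)\<^sup>2"
        by (simp add: lnT)
    qed (use q_pos[of x] in simp)
    also have "\<dots> = s * ((a * (norm x)\<^sup>2 + K) * q x)"
      by (simp add: algebra_simps)
    finally show "(\<integral>z. (norm z)\<^sup>2 * ?W z \<partial>\<nu>) \<le> (a * (norm x)\<^sup>2 + K) * q x"
      using s(1) by (simp only: mult_le_cancel_left_pos)
  qed (use a in auto)
qed

section \<open>The joint law of the mixture and the mixing variable\<close>

text \<open>
  The joint law of \<open>(X, Z)\<close>.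
\<close>

definition J :: "('a \<times> 'a) measure"
  where "J = distr (\<nu> \<Otimes>\<^sub>M gauss \<kappa>) (borel \<Otimes>\<^sub>M borel) (\<lambda>p. (snd p + fst p, fst p))"

lemma sets_J [simp, measurable_cong]: "sets J = sets (borel \<Otimes>\<^sub>M borel)"
  and space_J [simp]: "space J = UNIV"
  by (simp_all add: J_def space_pair_measure)

sublocale J: prob_space J
  unfolding J_def by (rule NG.prob_space_distr) measurable

lemma nn_integral_J:
  assumes F [measurable]: "F \<in> borel_measurable (borel \<Otimes>\<^sub>M borel)"
  shows "(\<integral>\<^sup>+p. F p \<partial>J) = (\<integral>\<^sup>+z. \<integral>\<^sup>+u. F (u + z, z) \<partial>gauss \<kappa> \<partial>\<nu>)"
  unfolding J_def
  by (subst nn_integral_distr) (simp_all add: G.nn_integral_fst[symmetric])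

lemma integral_J:
  fixes F :: "'a \<times> 'a \<Rightarrow> real"
  assumes F [measurable]: "integrable J F"
  shows "(\<integral>p. F p \<partial>J) = (\<integral>z. \<integral>u. F (u + z, z) \<partial>gauss \<kappa> \<partial>\<nu>)"
    and "integrable \<nu> (\<lambda>z. \<integral>u. F (u + z, z) \<partial>gauss \<kappa>)"
proof -
  have [measurable]: "F \<in> borel_measurable (borel \<Otimes>\<^sub>M borel)"
    using borel_measurable_integrable[OF F] by simp
  have i: "integrable (\<nu> \<Otimes>\<^sub>M gauss \<kappa>) (\<lambda>p. F (snd p + fst p, fst p))"
    using F unfolding J_def by (subst (asm) integrable_distr_eq) auto
  then show "integrable \<nu> (\<lambda>z. \<integral>u. F (u + z, z) \<partial>gauss \<kappa>)"
    using NG.integrable_fst'[OF i] by simp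
  show "(\<integral>p. F p \<partial>J) = (\<integral>z. \<integral>u. F (u + z, z) \<partial>gauss \<kappa> \<partial>\<nu>)"
    using NG.integral_fst'[OF i] unfolding J_def by (subst integral_distr) auto
qed

text \<open>
  Tonelli's theorem in the order that conditions on \<open>X\<close> instead of \<open>Z\<close>.
\<close>

lemma nn_integral_J_swap:
  assumes F [measurable]: "F \<in> borel_measurable (borel \<Otimes>\<^sub>M borel)"
  shows "(\<integral>\<^sup>+p. F p \<partial>J) = (\<integral>\<^sup>+x. \<integral>\<^sup>+z. ennreal (gauss_const TYPE('a) \<kappa> * exp (- (\<kappa> * (norm (x - z))\<^sup>2)))
    * F (x, z) \<partial>\<nu> \<partial>lborel)"
proof -
  let ?g = "\<lambda>x::'a. ennreal (gauss_const TYPE('a) \<kappa> * exp (- (\<kappa> * (norm x)\<^sup>2)))"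
  have "(\<integral>\<^sup>+u. F (u + z, z) \<partial>gauss \<kappa>) = (\<integral>\<^sup>+x. ?g (x - z) * F (x, z) \<partial>lborel)" for z
  proof -
    have "(\<integral>\<^sup>+x. ?g (x - z) * F (x, z) \<partial>lborel) = (\<integral>\<^sup>+u. ?g u * F (u + z, z) \<partial>lborel)"
      by (subst nn_integral_lborel_affine[of _ 1 z]) (simp_all add: add.commute)
    then show ?thesis
      by (subst nn_integral_gauss) simp_all
  qed
  then have "(\<integral>\<^sup>+p. F p \<partial>J) = (\<integral>\<^sup>+z. \<integral>\<^sup>+x. ?g (x - z) * F (x, z) \<partial>lborel \<partial>\<nu>)"
    by (simp add: nn_integral_J)
  also have "\<dots> = (\<integral>\<^sup>+x. \<integral>\<^sup>+z. ?g (x - z) * F (x, z) \<partial>\<nu> \<partial>lborel)"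
    by (rule NL.Fubini'[symmetric]) measurable
  finally show ?thesis .
qed

lemma integrable_J_noise: "integrable J (\<lambda>p. (norm (fst p - snd p))\<^sup>2)"
  and integrable_J_snd: "integrable J (\<lambda>p. (norm (snd p))\<^sup>2)"
proof -
  have "(\<integral>\<^sup>+u. ennreal ((norm u)\<^sup>2) \<partial>(gauss \<kappa> :: 'a measure)) < \<infinity>"
    using integrable_gauss_norm_sq[OF \<kappa>, where 'a='a] by (simp add: integrable_iff_bounded)
  then show "integrable J (\<lambda>p. (norm (fst p - snd p))\<^sup>2)"
    by (intro integrableI_nonneg) (auto simp: nn_integral_J N.emeasure_space_1[unfolded space_\<nu>])
  show "integrable J (\<lambda>p. (norm (snd p))\<^sup>2)"
    using integrable_norm_sq
    by (intro integrableI_nonneg) (auto simp: nn_integral_J G.emeasure_space_1[unfolded space_gibbs_measure] integrable_iff_bounded)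
qed

lemma integrable_J_fst: "integrable J (\<lambda>p. (norm (fst p))\<^sup>2)"
proof (rule Bochner_Integration.integrable_bound)
  show "integrable J (\<lambda>p. 2 * (norm (snd p))\<^sup>2 + 2 * (norm (fst p - snd p))\<^sup>2)"
    using integrable_J_noise integrable_J_snd by simp
  have "(norm x)\<^sup>2 \<le> 2 * (norm z)\<^sup>2 + 2 * (norm (x - z))\<^sup>2" for x z :: 'a
    using norm_sq_add_le[of 1 "x - z" z] by simp
  then show "AE p in J. norm ((norm (fst p))\<^sup>2) \<le> norm (2 * (norm (snd p))\<^sup>2 + 2 * (norm (fst p - snd p))\<^sup>2)"
    by (intro AE_I2) auto
qed simp

lemma integrable_bounded_mult_J:
  fixes g :: "'a \<Rightarrow> real"
  assumes [measurable]: "g \<in> borel_measurable borel" and "\<And>x. \<bar>g x\<bar> \<le> A" and W: "integrable J W"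
  shows "integrable J (\<lambda>p. g (fst p) * W p)"
proof (rule Bochner_Integration.integrable_bound)
  have [measurable]: "W \<in> borel_measurable (borel \<Otimes>\<^sub>M borel)"
    using borel_measurable_integrable[OF W] by simp
  show "integrable J (\<lambda>p. A * W p)"
    using W by simp
  show "(\<lambda>p. g (fst p) * W p) \<in> borel_measurable J"
    by measurable
  have "\<bar>g x\<bar> \<le> \<bar>A\<bar>" for x
    using assms(2)[of x] by linarith
  then show "AE p in J. norm (g (fst p) * W p) \<le> norm (A * W p)"
    by (intro AE_I2) (auto simp: abs_mult intro!: mult_right_mono)
qed

lemma integrable_J_Cb1:
  assumes f: "f \<in> Cb1" and W: "integrable J W"
  shows "integrable J (\<lambda>p. (f (fst p))\<^sup>2 * W p)"
    "integrable J (\<lambda>p. (norm (gradient f (fst p)))\<^sup>2 * W p)"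
proof -
  note [measurable] = Cb1_measurable[OF f] Cb1_measurable_gradient[OF f]
  obtain A where A: "A \<ge> 0" "\<And>x. \<bar>f x\<bar> \<le> A" "\<And>x. norm (gradient f x) \<le> A"
    by (rule Cb1_bounds[OF f]) (rule that)
  have sq: "\<bar>(f x)\<^sup>2\<bar> \<le> A\<^sup>2" "\<bar>(norm (gradient f x))\<^sup>2\<bar> \<le> A\<^sup>2" for x
    using A(1) A(2)[of x] A(3)[of x] by (auto simp: abs_le_square_iff[symmetric])
  show "integrable J (\<lambda>p. (f (fst p))\<^sup>2 * W p)"
    by (rule integrable_bounded_mult_J[OF _ sq(1) W]) measurable
  show "integrable J (\<lambda>p. (norm (gradient f (fst p)))\<^sup>2 * W p)"
    by (rule integrable_bounded_mult_J[OF _ sq(2) W]) measurable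
qed

lemmas integrable_J_Cb1' = integrable_J_Cb1[where W = "\<lambda>_. 1", simplified]

lemma noise_moment:
  assumes f: "f \<in> Cb1"
  shows "\<kappa> * (\<integral>p. (f (fst p))\<^sup>2 * (norm (fst p - snd p))\<^sup>2 \<partial>J)
    \<le> real DIM('a) * (\<integral>p. (f (fst p))\<^sup>2 \<partial>J) + (\<integral>p. (norm (gradient f (fst p)))\<^sup>2 \<partial>J) / \<kappa>"
proof -
  note i = integral_J(1)[OF integrable_J_Cb1(1)[OF f integrable_J_noise]]
    integral_J(1)[OF integrable_J_Cb1'(1)[OF f]] integral_J(1)[OF integrable_J_Cb1'(2)[OF f]]
  note j = integral_J(2)[OF integrable_J_Cb1(1)[OF f integrable_J_noise]]
    integral_J(2)[OF integrable_J_Cb1'(1)[OF f]] integral_J(2)[OF integrable_J_Cb1'(2)[OF f]]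
  have "(\<integral>z. \<kappa> * (\<integral>u. (f (u + z))\<^sup>2 * (norm u)\<^sup>2 \<partial>gauss \<kappa>) \<partial>\<nu>)
      \<le> (\<integral>z. real DIM('a) * (\<integral>u. (f (u + z))\<^sup>2 \<partial>gauss \<kappa>) + (\<integral>u. (norm (gradient f (u + z)))\<^sup>2 \<partial>gauss \<kappa>) / \<kappa> \<partial>\<nu>)"
    using j
    by (intro integral_mono gauss_weighted_moment[OF Cb1_translate(1)[OF f] \<kappa>, unfolded Cb1_translate(2)[OF f]]
        Bochner_Integration.integrable_add integrable_mult_right integrable_divide) auto
  then show ?thesis
    unfolding i using j by simp
qed

text \<open>
  The bound for the posterior second moment, integrated against \<open>f X ^ 2\<close>.
\<close>

lemma mixing_moment:
  obtains a K where "0 < a" "a < 1" "0 \<le> K"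
    "\<And>f. f \<in> Cb1 \<Longrightarrow> (\<integral>p. (f (fst p))\<^sup>2 * (norm (snd p))\<^sup>2 \<partial>J)
      \<le> a * (\<integral>p. (f (fst p))\<^sup>2 * (norm (fst p))\<^sup>2 \<partial>J) + K * (\<integral>p. (f (fst p))\<^sup>2 \<partial>J)"
proof -
  obtain a K where aK: "0 < a" "a < 1" "0 \<le> K"
    and post: "\<And>x. (\<integral>z. (norm z)\<^sup>2 * exp (- (\<kappa> * (norm (x - z))\<^sup>2)) \<partial>\<nu>) \<le> (a * (norm x)\<^sup>2 + K) * q x"
    by (rule posterior_second_moment) (rule that)
  let ?c = "gauss_const TYPE('a) \<kappa>"
  have c: "?c > 0"
    by (rule gauss_const_pos[OF \<kappa>])
  have main: "(\<integral>p. (f (fst p))\<^sup>2 * (norm (snd p))\<^sup>2 \<partial>J)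
      \<le> a * (\<integral>p. (f (fst p))\<^sup>2 * (norm (fst p))\<^sup>2 \<partial>J) + K * (\<integral>p. (f (fst p))\<^sup>2 \<partial>J)"
    if f: "f \<in> Cb1" for f
  proof -
    note [measurable] = Cb1_measurable[OF f]
    have inner: "(\<integral>\<^sup>+z. ennreal (?c * exp (- (\<kappa> * (norm (x - z))\<^sup>2))) * ennreal ((f x)\<^sup>2 * (norm z)\<^sup>2) \<partial>\<nu>)
        \<le> (\<integral>\<^sup>+z. ennreal (?c * exp (- (\<kappa> * (norm (x - z))\<^sup>2))) * ennreal ((f x)\<^sup>2 * (a * (norm x)\<^sup>2 + K)) \<partial>\<nu>)" for x
    proof -
      let ?W = "\<lambda>z. exp (- (\<kappa> * (norm (x - z))\<^sup>2))"
      have "(\<integral>\<^sup>+z. ennreal (?c * ?W z) * ennreal ((f x)\<^sup>2 * (norm z)\<^sup>2) \<partial>\<nu>)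
          = (\<integral>\<^sup>+z. ennreal (?c * (f x)\<^sup>2) * ennreal ((norm z)\<^sup>2 * ?W z) \<partial>\<nu>)"
        using c by (intro nn_integral_cong) (simp add: ennreal_mult[symmetric] mult_ac)
      also have "\<dots> = ennreal (?c * (f x)\<^sup>2) * ennreal (\<integral>z. (norm z)\<^sup>2 * ?W z \<partial>\<nu>)"
        using nn_integral_eq_integral[OF integrable_norm_sq_kernel[of x]] by (simp add: nn_integral_cmult)
      also have "\<dots> \<le> ennreal (?c * (f x)\<^sup>2) * ennreal ((a * (norm x)\<^sup>2 + K) * q x)"
        by (intro mult_left_mono ennreal_leI post) simp
      also have "\<dots> = ennreal (?c * (f x)\<^sup>2 * (a * (norm x)\<^sup>2 + K)) * ennreal (\<integral>z. ?W z \<partial>\<nu>)"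
        using aK c q_pos[of x] by (simp add: ennreal_mult'[symmetric] ennreal_mult''[symmetric] q_def mult_ac)
      also have "\<dots> = (\<integral>\<^sup>+z. ennreal (?c * (f x)\<^sup>2 * (a * (norm x)\<^sup>2 + K)) * ennreal (?W z) \<partial>\<nu>)"
        using nn_integral_eq_integral[OF integrable_kernel[of x]] by (simp add: nn_integral_cmult)
      also have "\<dots> = (\<integral>\<^sup>+z. ennreal (?c * ?W z) * ennreal ((f x)\<^sup>2 * (a * (norm x)\<^sup>2 + K)) \<partial>\<nu>)"
        using c aK by (intro nn_integral_cong) (simp add: ennreal_mult[symmetric] mult_ac)
      finally show ?thesis .
    qed
    have i1: "integrable J (\<lambda>p. (f (fst p))\<^sup>2 * (norm (snd p))\<^sup>2)"
      by (rule integrable_J_Cb1(1)[OF f integrable_J_snd])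
    have i2: "integrable J (\<lambda>p. (f (fst p))\<^sup>2 * (a * (norm (fst p))\<^sup>2 + K))"
      by (rule integrable_J_Cb1(1)[OF f]) (use integrable_J_fst in simp)
    have "(\<integral>\<^sup>+p. ennreal ((f (fst p))\<^sup>2 * (norm (snd p))\<^sup>2) \<partial>J)
        \<le> (\<integral>\<^sup>+p. ennreal ((f (fst p))\<^sup>2 * (a * (norm (fst p))\<^sup>2 + K)) \<partial>J)"
      using inner by (simp add: nn_integral_J_swap nn_integral_mono)
    then have "(\<integral>p. (f (fst p))\<^sup>2 * (norm (snd p))\<^sup>2 \<partial>J) \<le> (\<integral>p. (f (fst p))\<^sup>2 * (a * (norm (fst p))\<^sup>2 + K) \<partial>J)"
      using aK by (simp add: nn_integral_eq_integral[OF i1] nn_integral_eq_integral[OF i2])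
    also have "\<dots> = (\<integral>p. a * ((f (fst p))\<^sup>2 * (norm (fst p))\<^sup>2) + K * (f (fst p))\<^sup>2 \<partial>J)"
      by (simp add: algebra_simps)
    also have "\<dots> = a * (\<integral>p. (f (fst p))\<^sup>2 * (norm (fst p))\<^sup>2 \<partial>J) + K * (\<integral>p. (f (fst p))\<^sup>2 \<partial>J)"
      using integrable_J_Cb1(1)[OF f integrable_J_fst] integrable_J_Cb1'(1)[OF f] by simp
    finally show ?thesis .
  qed
  show thesis
    by (rule that[OF aK main])
qed

text \<open>
  Split \<open>X = Z + (X - Z)\<close> with a weight \<open>1 + \<eta>\<close> on \<open>norm Z ^ 2\<close> that is so close to 1 that
  \<open>(1 + \<eta>) * a\<close> is still smaller than 1.  The part of \<open>norm Z ^ 2\<close> that is bounded by \<open>norm X ^ 2\<close> is then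
  absorbed, which is legitimate because all integrals are finite for bounded \<open>f\<close>.
\<close>

lemma second_moment_control:
  obtains A B where "A > 0" "B > 0"
    "\<And>f. f \<in> Cb1 \<Longrightarrow> (\<integral>p. (f (fst p))\<^sup>2 * ((norm (fst p))\<^sup>2 + (norm (snd p))\<^sup>2) \<partial>J)
      \<le> A * (\<integral>p. (norm (gradient f (fst p)))\<^sup>2 \<partial>J) + B * (\<integral>p. (f (fst p))\<^sup>2 \<partial>J)"
proof -
  obtain a K where aK: "0 < a" "a < 1" "0 \<le> K"
    and mix: "\<And>f. f \<in> Cb1 \<Longrightarrow> (\<integral>p. (f (fst p))\<^sup>2 * (norm (snd p))\<^sup>2 \<partial>J)
      \<le> a * (\<integral>p. (f (fst p))\<^sup>2 * (norm (fst p))\<^sup>2 \<partial>J) + K * (\<integral>p. (f (fst p))\<^sup>2 \<partial>J)"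
    by (rule mixing_moment) (rule that)
  define \<eta> where "\<eta> = (1 - a) / 2"
  have \<eta>: "\<eta> > 0" "(1 + \<eta>) * a \<le> (1 + a) / 2"
  proof -
    show "\<eta> > 0" using aK by (simp add: \<eta>_def)
    have "a * \<eta> \<le> 1 * \<eta>"
      using aK \<open>\<eta> > 0\<close> by (intro mult_right_mono) auto
    then show "(1 + \<eta>) * a \<le> (1 + a) / 2"
      by (simp add: \<eta>_def field_simps)
  qed
  define d where "d = real DIM('a)"
  have d: "d > 0" by (simp add: d_def)
  define h where "h = 1 + 1 / \<eta>"
  have h: "h > 0" using \<eta> by (simp add: h_def add_pos_pos)
  define A where "A = 2 / (1 - a) * (h / \<kappa>\<^sup>2)"
  define B where "B = 2 / (1 - a) * ((1 + \<eta>) * K + h * d / \<kappa>)"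
  have "0 < (1 + \<eta>) * K + h * d / \<kappa>"
    using aK \<eta> h d \<kappa> by (intro add_nonneg_pos) auto
  then have AB: "A > 0" "B > 0"
    using aK h \<kappa> by (simp_all add: A_def B_def)
  have main: "(\<integral>p. (f (fst p))\<^sup>2 * ((norm (fst p))\<^sup>2 + (norm (snd p))\<^sup>2) \<partial>J)
      \<le> (2 * A) * (\<integral>p. (norm (gradient f (fst p)))\<^sup>2 \<partial>J) + (2 * B + K) * (\<integral>p. (f (fst p))\<^sup>2 \<partial>J)"
    if f: "f \<in> Cb1" for f
  proof -
    define Y where "Y = (\<integral>p. (f (fst p))\<^sup>2 * (norm (fst p))\<^sup>2 \<partial>J)"
    define Z where "Z = (\<integral>p. (f (fst p))\<^sup>2 * (norm (snd p))\<^sup>2 \<partial>J)"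
    define W where "W = (\<integral>p. (f (fst p))\<^sup>2 * (norm (fst p - snd p))\<^sup>2 \<partial>J)"
    define n where "n = (\<integral>p. (f (fst p))\<^sup>2 \<partial>J)"
    define D where "D = (\<integral>p. (norm (gradient f (fst p)))\<^sup>2 \<partial>J)"
    have nonneg: "Y \<ge> 0" "n \<ge> 0" "D \<ge> 0"
      by (simp_all add: Y_def n_def D_def)
    note iY = integrable_J_Cb1(1)[OF f integrable_J_fst]
    note iZ = integrable_J_Cb1(1)[OF f integrable_J_snd]
    note iW = integrable_J_Cb1(1)[OF f integrable_J_noise]
    have Z: "Z \<le> a * Y + K * n"
      using mix[OF f] by (simp add: Y_def Z_def n_def)
    have W: "\<kappa> * W \<le> d * n + D / \<kappa>"
      using noise_moment[OF f] by (simp add: W_def n_def D_def d_def)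
    have "Y \<le> (\<integral>p. (1 + \<eta>) * ((f (fst p))\<^sup>2 * (norm (snd p))\<^sup>2) + h * ((f (fst p))\<^sup>2 * (norm (fst p - snd p))\<^sup>2) \<partial>J)"
      unfolding Y_def
    proof (rule integral_mono[OF iY])
      show "integrable J (\<lambda>p. (1 + \<eta>) * ((f (fst p))\<^sup>2 * (norm (snd p))\<^sup>2) + h * ((f (fst p))\<^sup>2 * (norm (fst p - snd p))\<^sup>2))"
        using iZ iW by simp
      fix p :: "'a \<times> 'a"
      have "(norm (fst p))\<^sup>2 \<le> (1 + \<eta>) * (norm (snd p))\<^sup>2 + h * (norm (fst p - snd p))\<^sup>2"
        using norm_sq_add_le[OF \<eta>(1), of "fst p - snd p" "snd p"] by (simp add: h_def)
      from mult_left_mono[OF this, of "(f (fst p))\<^sup>2"]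
      show "(f (fst p))\<^sup>2 * (norm (fst p))\<^sup>2
          \<le> (1 + \<eta>) * ((f (fst p))\<^sup>2 * (norm (snd p))\<^sup>2) + h * ((f (fst p))\<^sup>2 * (norm (fst p - snd p))\<^sup>2)"
        by (simp add: algebra_simps)
    qed
    also have "\<dots> = (1 + \<eta>) * Z + h * W"
      using iZ iW by (simp add: Z_def W_def)
    also have "\<dots> \<le> (1 + \<eta>) * (a * Y + K * n) + h * ((d * n + D / \<kappa>) / \<kappa>)"
    proof (intro add_mono mult_left_mono Z)
      show "W \<le> (d * n + D / \<kappa>) / \<kappa>"
        using W \<kappa> by (simp add: field_simps)
    qed (use \<eta> h in auto)
    also have "(1 + \<eta>) * (a * Y + K * n) = ((1 + \<eta>) * a) * Y + (1 + \<eta>) * K * n"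
      by (simp add: algebra_simps)
    also have "((1 + \<eta>) * a) * Y \<le> (1 + a) / 2 * Y"
      using \<eta>(2) nonneg(1) by (rule mult_right_mono)
    finally have "(1 - a) / 2 * Y \<le> (1 + \<eta>) * K * n + h * ((d * n + D / \<kappa>) / \<kappa>)"
      by (simp add: field_simps)
    then have "2 / (1 - a) * ((1 - a) / 2 * Y) \<le> 2 / (1 - a) * ((1 + \<eta>) * K * n + h * ((d * n + D / \<kappa>) / \<kappa>))"
      using aK by (intro mult_left_mono) auto
    also have "2 / (1 - a) * ((1 - a) / 2 * Y) = Y"
      using aK by simp
    also have "2 / (1 - a) * ((1 + \<eta>) * K * n + h * ((d * n + D / \<kappa>) / \<kappa>)) = A * D + B * n"
      by (simp add: A_def B_def distrib_left distrib_right add_divide_distrib power2_eq_square mult_ac)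
    finally have Y: "Y \<le> A * D + B * n" .
    have "a * Y \<le> 1 * Y"
      using aK nonneg by (intro mult_right_mono) auto
    then have "Y + Z \<le> 2 * Y + K * n"
      using Z by linarith
    then have "Y + Z \<le> (2 * A) * D + (2 * B + K) * n"
      using Y by (simp add: algebra_simps)
    then show ?thesis
      using iY iZ by (simp add: Y_def Z_def n_def D_def distrib_left)
  qed
  show thesis
    by (rule that[of "2 * A" "2 * B + K", OF _ _ main]) (use AB aK in auto)
qed

lemma nn_integral_J_fst:
  assumes [measurable]: "F \<in> borel_measurable borel"
  shows "(\<integral>\<^sup>+p. F (fst p) \<partial>J) = (\<integral>\<^sup>+x. ennreal (gauss_const TYPE('a) \<kappa> * q x) * F x \<partial>lborel)"
proof -
  let ?c = "gauss_const TYPE('a) \<kappa>"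
  have c: "?c > 0"
    by (rule gauss_const_pos[OF \<kappa>])
  have "(\<integral>\<^sup>+z. ennreal (?c * exp (- (\<kappa> * (norm (x - z))\<^sup>2))) * F x \<partial>\<nu>) = ennreal (?c * q x) * F x" for x
  proof -
    have "(\<integral>\<^sup>+z. ennreal (?c * exp (- (\<kappa> * (norm (x - z))\<^sup>2))) \<partial>\<nu>) = ennreal (\<integral>z. ?c * exp (- (\<kappa> * (norm (x - z))\<^sup>2)) \<partial>\<nu>)"
      using c integrable_kernel[of x] by (intro nn_integral_eq_integral) auto
    then show ?thesis
      by (simp add: nn_integral_multc q_def)
  qed
  then show ?thesis
    by (subst nn_integral_J_swap) simp_all
qed

definition energy :: "('a \<Rightarrow> real) \<Rightarrow> real"
  where "energy f = (\<integral>p. (norm (gradient f (fst p)))\<^sup>2 \<partial>J)"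

definition mass :: "('a \<Rightarrow> real) \<Rightarrow> real"
  where "mass f = (\<integral>p. (f (fst p))\<^sup>2 \<partial>J)"

lemma energy_nonneg: "energy f \<ge> 0" and mass_nonneg: "mass f \<ge> 0"
  by (simp_all add: energy_def mass_def)

lemma nn_integral_energy:
  assumes "f \<in> Cb1"
  shows "(\<integral>\<^sup>+p. ennreal ((norm (gradient f (fst p)))\<^sup>2) \<partial>J) = ennreal (energy f)"
  unfolding energy_def using integrable_J_Cb1'(2)[OF assms] by (intro nn_integral_eq_integral) auto

lemma nn_integral_mass:
  assumes "f \<in> Cb1"
  shows "(\<integral>\<^sup>+p. ennreal ((f (fst p))\<^sup>2) \<partial>J) = ennreal (mass f)"
  unfolding mass_def using integrable_J_Cb1'(1)[OF assms] by (intro nn_integral_eq_integral) auto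

section \<open>Defective log-Sobolev inequality\<close>

text \<open>
  Mean square change of \<open>f\<close> when the Gaussian part of \<open>X\<close> is rotated by the angle \<open>t\<close> towards a fresh
  Gaussian vector, conditionally on \<open>(X, Z) = p\<close>.
\<close>

definition deviation :: "('a \<Rightarrow> real) \<Rightarrow> real \<Rightarrow> 'a \<times> 'a \<Rightarrow> ennreal"
  where "deviation f t p = (\<integral>\<^sup>+y. ennreal ((f (fst p) - f (cos t *\<^sub>R (fst p - snd p) + sin t *\<^sub>R y + snd p))\<^sup>2) \<partial>gauss \<kappa>)"

lemma deviation_measurable [measurable]:
  assumes f: "f \<in> Cb1"
  shows "deviation f t \<in> borel_measurable (borel \<Otimes>\<^sub>M borel)"
proof -
  note [measurable] = Cb1_measurable[OF f]
  show ?thesis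
    unfolding deviation_def by measurable
qed

lemma nn_integral_deviation_le:
  assumes f: "f \<in> Cb1" and t: "0 \<le> t" "t < pi"
  shows "(\<integral>\<^sup>+p. deviation f t p \<partial>J) \<le> ennreal (t\<^sup>2 * gauss_variance TYPE('a) \<kappa> * energy f)"
proof -
  note [measurable] = Cb1_measurable[OF f] Cb1_measurable_gradient[OF f] deviation_measurable[OF f]
  have S: "(\<integral>\<^sup>+y. ennreal ((norm y)\<^sup>2) \<partial>(gauss \<kappa> :: 'a measure)) = ennreal (gauss_variance TYPE('a) \<kappa>)"
    unfolding gauss_variance_def using integrable_gauss_norm_sq[OF \<kappa>] by (intro nn_integral_eq_integral) auto
  have "gauss_variance TYPE('a) \<kappa> \<ge> 0"
    by (simp add: gauss_variance_def)
  have "(\<integral>\<^sup>+p. deviation f t p \<partial>J)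
      = (\<integral>\<^sup>+z. \<integral>\<^sup>+u. \<integral>\<^sup>+y. ennreal ((f (u + z) - f (cos t *\<^sub>R u + sin t *\<^sub>R y + z))\<^sup>2) \<partial>gauss \<kappa> \<partial>gauss \<kappa> \<partial>\<nu>)"
    by (subst nn_integral_J) (simp_all add: deviation_def)
  also have "\<dots> \<le> (\<integral>\<^sup>+z. ennreal (t\<^sup>2) * ((\<integral>\<^sup>+u. ennreal ((norm (gradient f (u + z)))\<^sup>2) \<partial>gauss \<kappa>) * ennreal (gauss_variance TYPE('a) \<kappa>)) \<partial>\<nu>)"
    using gauss_rotation_energy[OF Cb1_translate(1)[OF f] \<kappa> t, unfolded S Cb1_translate(2)[OF f]]
    by (intro nn_integral_mono) simp
  also have "\<dots> = ennreal (t\<^sup>2) * ((\<integral>\<^sup>+p. ennreal ((norm (gradient f (fst p)))\<^sup>2) \<partial>J) * ennreal (gauss_variance TYPE('a) \<kappa>))"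
    by (subst nn_integral_J) (simp_all add: nn_integral_cmult nn_integral_multc)
  also have "\<dots> = ennreal (t\<^sup>2 * gauss_variance TYPE('a) \<kappa> * energy f)"
    using \<open>gauss_variance TYPE('a) \<kappa> \<ge> 0\<close> energy_nonneg[of f]
    by (simp add: nn_integral_energy[OF f] ennreal_mult[symmetric] mult_ac)
  finally show ?thesis .
qed

text \<open>
  The density of \<open>m + s * Y\<close> is at most \<open>s ^ (- d)\<close> times a Gaussian of width \<open>s\<close> around \<open>m\<close>.  For
  \<open>s \<le> 1 / 2\<close> the negative exponent is at least \<open>4 * \<kappa> * norm (v - m) ^ 2\<close>, hence at least
  \<open>2 * \<kappa> * norm v ^ 2 - 4 * \<kappa> * norm m ^ 2\<close>.  So this Gaussian is at most a multiple, depending on \<open>m\<close>, of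
  the density of \<open>X\<close>.
\<close>

lemma smoothing_bound:
  obtains C where "C > 0"
    "\<And>f s m. f \<in> Cb1 \<Longrightarrow> 0 < s \<Longrightarrow> s \<le> 1 / 2 \<Longrightarrow>
      (\<integral>\<^sup>+y. ennreal ((f (m + s *\<^sub>R y))\<^sup>2) \<partial>gauss \<kappa>)
        \<le> ennreal (C / s ^ DIM('a) * exp (4 * \<kappa> * (norm m)\<^sup>2) * mass f)"
proof -
  obtain c where c: "c > 0" "\<And>x. c * exp (- ((1 + 1) * \<kappa> * (norm x)\<^sup>2)) \<le> q x"
    by (rule q_lower_bound[of 1]) auto
  let ?g = "gauss_const TYPE('a) \<kappa>"
  have g: "?g > 0"
    by (rule gauss_const_pos[OF \<kappa>])
  have main: "(\<integral>\<^sup>+y. ennreal ((f (m + s *\<^sub>R y))\<^sup>2) \<partial>gauss \<kappa>)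
        \<le> ennreal (1 / c / s ^ DIM('a) * exp (4 * \<kappa> * (norm m)\<^sup>2) * mass f)" (is "?I \<le> _")
    if f: "f \<in> Cb1" and s: "0 < s" "s \<le> 1 / 2" for f s m
  proof -
    note [measurable] = Cb1_measurable[OF f]
    let ?E = "exp (4 * \<kappa> * (norm m)\<^sup>2)"
    define F where "F v = ennreal (?g * exp (- (\<kappa> * (norm ((1 / s) *\<^sub>R (v - m)))\<^sup>2))) * ennreal ((f v)\<^sup>2)" for v
    have [measurable]: "F \<in> borel_measurable borel"
      unfolding F_def by measurable
    have "?I = (\<integral>\<^sup>+y. F (m + s *\<^sub>R y) \<partial>lborel)"
      using s by (subst nn_integral_gauss) (auto simp: F_def)
    then have "ennreal (s ^ DIM('a)) * ?I = (\<integral>\<^sup>+v. F v \<partial>lborel)"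
      using s by (subst nn_integral_lborel_affine[of F s m]) auto
    also have "\<dots> \<le> (\<integral>\<^sup>+v. ennreal (1 / c * ?E) * (ennreal (?g * q v) * ennreal ((f v)\<^sup>2)) \<partial>lborel)"
    proof (rule nn_integral_mono)
      fix v
      have "4 * (norm (v - m))\<^sup>2 \<le> (norm ((1 / s) *\<^sub>R (v - m)))\<^sup>2"
      proof -
        have "2 * norm (v - m) \<le> 1 / s * norm (v - m)"
          using s by (intro mult_right_mono) (auto simp: field_simps)
        then have "(2 * norm (v - m))\<^sup>2 \<le> (1 / s * norm (v - m))\<^sup>2"
          by (rule power_mono) simp
        then show ?thesis
          using s by (simp add: power_mult_distrib)
      qed
      moreover have "(norm v)\<^sup>2 \<le> 2 * (norm m)\<^sup>2 + 2 * (norm (v - m))\<^sup>2"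
        using norm_sq_add_le[of 1 "v - m" m] by simp
      ultimately have "2 * (norm v)\<^sup>2 - 4 * (norm m)\<^sup>2 \<le> (norm ((1 / s) *\<^sub>R (v - m)))\<^sup>2"
        by linarith
      then have "\<kappa> * (2 * (norm v)\<^sup>2 - 4 * (norm m)\<^sup>2) \<le> \<kappa> * (norm ((1 / s) *\<^sub>R (v - m)))\<^sup>2"
        using \<kappa> by (intro mult_left_mono) auto
      then have "exp (- (\<kappa> * (norm ((1 / s) *\<^sub>R (v - m)))\<^sup>2)) \<le> exp (- ((1 + 1) * \<kappa> * (norm v)\<^sup>2) + 4 * \<kappa> * (norm m)\<^sup>2)"
        by (simp add: algebra_simps)
      also have "\<dots> \<le> 1 / c * q v * ?E"
        unfolding exp_add using c by (intro mult_right_mono) (auto simp: field_simps)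
      finally have "?g * exp (- (\<kappa> * (norm ((1 / s) *\<^sub>R (v - m)))\<^sup>2)) * (f v)\<^sup>2 \<le> ?g * (1 / c * q v * ?E) * (f v)\<^sup>2"
        using g by (intro mult_right_mono mult_left_mono) auto
      then have "F v \<le> ennreal (?g * (1 / c * q v * ?E) * (f v)\<^sup>2)"
        unfolding F_def using g by (simp add: ennreal_mult[symmetric] ennreal_leI)
      also have "\<dots> = ennreal (1 / c * ?E) * (ennreal (?g * q v) * ennreal ((f v)\<^sup>2))"
        using g c q_pos[of v] by (simp add: ennreal_mult[symmetric] mult_ac)
      finally show "F v \<le> ennreal (1 / c * ?E) * (ennreal (?g * q v) * ennreal ((f v)\<^sup>2))" .
    qed
    also have "\<dots> = ennreal (1 / c * ?E) * (\<integral>\<^sup>+p. ennreal ((f (fst p))\<^sup>2) \<partial>J)"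
    proof -
      have [measurable]: "q \<in> borel_measurable borel"
        unfolding q_def by measurable
      show ?thesis
        by (subst nn_integral_J_fst) (simp_all add: nn_integral_cmult)
    qed
    also have "\<dots> = ennreal (1 / c * ?E * mass f)"
      using c mass_nonneg[of f] by (simp add: nn_integral_mass[OF f] ennreal_mult[symmetric])
    finally have "ennreal (1 / s ^ DIM('a)) * (ennreal (s ^ DIM('a)) * ?I) \<le> ennreal (1 / s ^ DIM('a)) * ennreal (1 / c * ?E * mass f)"
      by (rule mult_left_mono) simp
    also have "ennreal (1 / s ^ DIM('a)) * (ennreal (s ^ DIM('a)) * ?I) = ?I"
      using s by (simp add: mult.assoc[symmetric] ennreal_mult[symmetric])
    also have "ennreal (1 / s ^ DIM('a)) * ennreal (1 / c * ?E * mass f)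
        = ennreal (1 / c / s ^ DIM('a) * ?E * mass f)"
      using s c mass_nonneg[of f] by (simp add: ennreal_mult[symmetric] mult_ac)
    finally show ?thesis .
  qed
  show thesis
    by (rule that[of "1 / c", OF _ main]) (use c in auto)
qed

text \<open>
  On such a level set the average of \<open>f ^ 2\<close> over the rotated points is at most \<open>f x ^ 2 / 4\<close>, because
  \<open>T\<close> is four times the constant of the smoothing bound (the factor \<open>4 ^ d\<close> comes from
  \<open>sin t \<ge> t / 2\<close> and \<open>t = 2 ^ (- k - 1)\<close>).  Since \<open>f x ^ 2\<close> is at most twice the mean square change plus twice
  this average, half of it is absorbed.
\<close>

lemma level_set_bound:
  obtains T where "T > 0"
    "\<And>f k x z. f \<in> Cb1 \<Longrightarrow> mass f \<le> 1 \<Longrightarrow>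
      2 ^ (k * DIM('a)) * (T * exp (8 * \<kappa> * ((norm x)\<^sup>2 + (norm z)\<^sup>2))) < (f x)\<^sup>2 \<Longrightarrow>
      ennreal ((f x)\<^sup>2) \<le> 4 * deviation f (1 / 2 ^ Suc k) (x, z)"
proof -
  obtain C where C: "C > 0" "\<And>f s m. f \<in> Cb1 \<Longrightarrow> 0 < s \<Longrightarrow> s \<le> 1 / 2 \<Longrightarrow>
      (\<integral>\<^sup>+y. ennreal ((f (m + s *\<^sub>R y))\<^sup>2) \<partial>gauss \<kappa>)
        \<le> ennreal (C / s ^ DIM('a) * exp (4 * \<kappa> * (norm m)\<^sup>2) * mass f)"
    by (rule smoothing_bound) (rule that)
  \<comment> \<open>four times the smoothing constant, times the loss from replacing the sine by half the angle\<close>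
  define T where "T = 4 * C * 4 ^ DIM('a)"
  have main: "ennreal ((f x)\<^sup>2) \<le> 4 * deviation f (1 / 2 ^ Suc k) (x, z)"
    if f: "f \<in> Cb1" and mass: "mass f \<le> 1"
      and level: "2 ^ (k * DIM('a)) * (T * exp (8 * \<kappa> * ((norm x)\<^sup>2 + (norm z)\<^sup>2))) < (f x)\<^sup>2" for f k x z
  proof -
    note [measurable] = Cb1_measurable[OF f]
    define t :: real where "t = 1 / 2 ^ Suc k"
    have t: "0 < t" "t \<le> 1 / 2"
      by (simp_all add: t_def divide_simps)
    define s where "s = sin t"
    have s: "t / 2 \<le> s" "s \<le> 1 / 2" "0 < s"
      using half_le_sin[of t] sin_x_le_x[of t] t by (auto simp: s_def)
    define m where "m = cos t *\<^sub>R (x - z) + z"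
    have m: "(norm m)\<^sup>2 \<le> 2 * ((norm x)\<^sup>2 + (norm z)\<^sup>2)"
    proof -
      have cos: "0 \<le> cos t" "cos t \<le> 1"
        using t pi_gt3 by (auto intro!: cos_ge_zero)
      have "m = cos t *\<^sub>R x + (1 - cos t) *\<^sub>R z"
        by (simp add: m_def algebra_simps)
      then have "norm m \<le> cos t * norm x + (1 - cos t) * norm z"
        using cos norm_triangle_ineq[of "cos t *\<^sub>R x" "(1 - cos t) *\<^sub>R z"] by simp
      also have "\<dots> \<le> 1 * norm x + 1 * norm z"
        using cos by (intro add_mono mult_right_mono) auto
      finally have "(norm m)\<^sup>2 \<le> (norm x + norm z)\<^sup>2"
        by (intro power_mono) auto
      also have "\<dots> \<le> 2 * ((norm x)\<^sup>2 + (norm z)\<^sup>2)"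
        using zero_le_power2[of "norm x - norm z"] by (simp add: power2_eq_square algebra_simps)
      finally show ?thesis .
    qed
    let ?E = "exp (8 * \<kappa> * ((norm x)\<^sup>2 + (norm z)\<^sup>2))"
    let ?y = "\<lambda>y. cos t *\<^sub>R (x - z) + s *\<^sub>R y + z"
    have "(\<integral>\<^sup>+y. ennreal ((f (?y y))\<^sup>2) \<partial>gauss \<kappa>) = (\<integral>\<^sup>+y. ennreal ((f (m + s *\<^sub>R y))\<^sup>2) \<partial>gauss \<kappa>)"
      by (simp add: m_def add_ac)
    also have "\<dots> \<le> ennreal (C / s ^ DIM('a) * exp (4 * \<kappa> * (norm m)\<^sup>2) * mass f)"
      using C(2)[OF f s(3,2)] .
    also have "\<dots> \<le> ennreal ((f x)\<^sup>2 / 4)"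
    proof (rule ennreal_leI)
      have "1 / 2 ^ (k + 2) \<le> s"
        using s(1) by (simp add: t_def)
      then have "(1 / 2 ^ (k + 2)) ^ DIM('a) \<le> s ^ DIM('a)"
        by (rule power_mono) simp
      then have "1 / s ^ DIM('a) \<le> 1 / (1 / 2 ^ (k + 2)) ^ DIM('a)"
        by (intro divide_left_mono mult_pos_pos) (use s in auto)
      also have "\<dots> = 4 ^ DIM('a) * 2 ^ (k * DIM('a))"
        by (simp add: power_divide power_mult_distrib power_mult power_add mult.commute)
      finally have "C / s ^ DIM('a) \<le> C * (4 ^ DIM('a) * 2 ^ (k * DIM('a)))"
        using mult_left_mono[of _ _ C] C(1) by fastforce
      moreover have "exp (4 * \<kappa> * (norm m)\<^sup>2) \<le> ?E"
        using mult_left_mono[OF m, of "4 * \<kappa>"] \<kappa> by simp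
      ultimately have "C / s ^ DIM('a) * exp (4 * \<kappa> * (norm m)\<^sup>2) \<le> C * (4 ^ DIM('a) * 2 ^ (k * DIM('a))) * ?E"
        using C(1) by (intro mult_mono) auto
      moreover have "C / s ^ DIM('a) * exp (4 * \<kappa> * (norm m)\<^sup>2) * mass f \<le> C / s ^ DIM('a) * exp (4 * \<kappa> * (norm m)\<^sup>2) * 1"
        using mass C(1) s by (intro mult_left_mono) auto
      moreover have "C * (4 ^ DIM('a) * 2 ^ (k * DIM('a))) * ?E \<le> (f x)\<^sup>2 / 4"
        using level by (simp add: T_def algebra_simps)
      ultimately show "C / s ^ DIM('a) * exp (4 * \<kappa> * (norm m)\<^sup>2) * mass f \<le> (f x)\<^sup>2 / 4"
        by linarith
    qed
    finally have smooth: "(\<integral>\<^sup>+y. ennreal ((f (?y y))\<^sup>2) \<partial>gauss \<kappa>) \<le> ennreal ((f x)\<^sup>2 / 4)" .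
    have "ennreal ((f x)\<^sup>2) = (\<integral>\<^sup>+y. ennreal ((f x)\<^sup>2) \<partial>(gauss \<kappa> :: 'a measure))"
      using G.emeasure_space_1 by simp
    also have "\<dots> \<le> (\<integral>\<^sup>+y. 2 * ennreal ((f x - f (?y y))\<^sup>2) + 2 * ennreal ((f (?y y))\<^sup>2) \<partial>gauss \<kappa>)"
    proof (rule nn_integral_mono)
      fix y
      have "(f x)\<^sup>2 \<le> 2 * (f x - f (?y y))\<^sup>2 + 2 * (f (?y y))\<^sup>2"
        using zero_le_power2[of "f x - 2 * f (?y y)"] by (simp add: power2_eq_square algebra_simps)
      then have "ennreal ((f x)\<^sup>2) \<le> ennreal (2 * (f x - f (?y y))\<^sup>2 + 2 * (f (?y y))\<^sup>2)"
        by (rule ennreal_leI)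
      then show "ennreal ((f x)\<^sup>2) \<le> 2 * ennreal ((f x - f (?y y))\<^sup>2) + 2 * ennreal ((f (?y y))\<^sup>2)"
        by (simp add: ennreal_mult)
    qed
    also have "\<dots> = 2 * deviation f t (x, z) + 2 * (\<integral>\<^sup>+y. ennreal ((f (?y y))\<^sup>2) \<partial>gauss \<kappa>)"
      by (simp add: deviation_def s_def nn_integral_add nn_integral_cmult)
    also have "\<dots> \<le> 2 * deviation f t (x, z) + 2 * ennreal ((f x)\<^sup>2 / 4)"
      by (intro add_left_mono mult_left_mono smooth) simp
    finally have *: "ennreal ((f x)\<^sup>2) \<le> 2 * deviation f t (x, z) + 2 * ennreal ((f x)\<^sup>2 / 4)" .
    show ?thesis
      unfolding t_def[symmetric]
    proof (cases "deviation f t (x, z)" rule: ennreal_cases)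
      case (real r)
      have "ennreal ((f x)\<^sup>2) \<le> ennreal (2 * r + 2 * ((f x)\<^sup>2 / 4))"
        using * real by (simp add: ennreal_mult' ennreal_plus del: times_divide_eq_right)
      then have "(f x)\<^sup>2 \<le> 2 * r + 2 * ((f x)\<^sup>2 / 4)"
        using real by (subst (asm) ennreal_le_iff) auto
      then have "ennreal ((f x)\<^sup>2) \<le> ennreal (4 * r)"
        by (intro ennreal_leI) linarith
      then show "ennreal ((f x)\<^sup>2) \<le> 4 * deviation f t (x, z)"
        using real by (simp add: ennreal_mult')
    qed (simp add: ennreal_mult_top)
  qed
  show thesis
    by (rule that[of T, OF _ main]) (use C in \<open>auto simp: T_def\<close>)
qed

text \<open>
  The deviation at the angle \<open>2 ^ (- k - 1)\<close> is of order \<open>4 ^ (- k)\<close> times the energy, so the sum of the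
  level set bounds over all \<open>k\<close> converges.
\<close>

lemma layer_cake:
  obtains T A where "T > 0" "A > 0"
    "\<And>f. f \<in> Cb1 \<Longrightarrow> mass f \<le> 1 \<Longrightarrow>
      (\<integral>\<^sup>+p. ennreal ((f (fst p))\<^sup>2 * ln (max 1 ((f (fst p))\<^sup>2
          / (T * exp (8 * \<kappa> * ((norm (fst p))\<^sup>2 + (norm (snd p))\<^sup>2)))))) \<partial>J)
        \<le> ennreal (A * energy f)"
proof -
  obtain T where T: "T > 0" "\<And>f k x z. f \<in> Cb1 \<Longrightarrow> mass f \<le> 1 \<Longrightarrow>
      2 ^ (k * DIM('a)) * (T * exp (8 * \<kappa> * ((norm x)\<^sup>2 + (norm z)\<^sup>2))) < (f x)\<^sup>2 \<Longrightarrow>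
      ennreal ((f x)\<^sup>2) \<le> 4 * deviation f (1 / 2 ^ Suc k) (x, z)"
    by (rule level_set_bound) (rule that)
  define L where "L = real DIM('a) * ln 2"
  have L: "L > 0"
    by (simp add: L_def)
  have S: "gauss_variance TYPE('a) \<kappa> \<ge> 0"
    by (simp add: gauss_variance_def)
  have main: "(\<integral>\<^sup>+p. ennreal ((f (fst p))\<^sup>2 * ln (max 1 ((f (fst p))\<^sup>2
          / (T * exp (8 * \<kappa> * ((norm (fst p))\<^sup>2 + (norm (snd p))\<^sup>2)))))) \<partial>J)
        \<le> ennreal ((2 * L * gauss_variance TYPE('a) \<kappa> + 1) * energy f)"
    if f: "f \<in> Cb1" and mass: "mass f \<le> 1" for f
  proof -
    note [measurable] = Cb1_measurable[OF f] deviation_measurable[OF f]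
    have pw: "ennreal ((f (fst p))\<^sup>2 * ln (max 1 ((f (fst p))\<^sup>2
          / (T * exp (8 * \<kappa> * ((norm (fst p))\<^sup>2 + (norm (snd p))\<^sup>2))))))
        \<le> (\<Sum>k. ennreal (4 * L) * deviation f (1 / 2 ^ Suc k) p)" for p
    proof -
      obtain x z where p: "p = (x, z)"
        by (cases p)
      define \<tau> where "\<tau> = T * exp (8 * \<kappa> * ((norm x)\<^sup>2 + (norm z)\<^sup>2))"
      have \<tau>: "\<tau> > 0"
        using T(1) by (simp add: \<tau>_def)
      define w where "w = (f x)\<^sup>2 / \<tau>"
      have "ennreal ((f x)\<^sup>2 * ln (max 1 w)) \<le> (\<Sum>k. ennreal (4 * L) * deviation f (1 / 2 ^ Suc k) (x, z))"
      proof (cases "1 < w")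
        case True
        obtain n where n: "ln w \<le> real n * L" "\<And>k. k < n \<Longrightarrow> 2 ^ (k * DIM('a)) < w"
          using dyadic_log_bound[OF True, of "DIM('a)"] by (auto simp: L_def)
        have dev: "ennreal ((f x)\<^sup>2) \<le> 4 * deviation f (1 / 2 ^ Suc k) (x, z)" if "k < n" for k
          using n(2)[OF that] \<tau> by (intro T(2)[OF f mass]) (simp add: w_def \<tau>_def field_simps)
        have "ennreal ((f x)\<^sup>2 * ln (max 1 w)) \<le> ennreal ((f x)\<^sup>2 * (real n * L))"
          using True n(1) by (intro ennreal_leI mult_left_mono) auto
        also have "\<dots> = (\<Sum>k<n. ennreal L * ennreal ((f x)\<^sup>2))"
          using L by (simp add: ennreal_of_nat_eq_real_of_nat ennreal_mult[symmetric] mult_ac)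
        also have "\<dots> \<le> (\<Sum>k<n. ennreal L * (4 * deviation f (1 / 2 ^ Suc k) (x, z)))"
          using dev by (intro sum_mono mult_left_mono) auto
        also have "\<dots> = (\<Sum>k<n. ennreal (4 * L) * deviation f (1 / 2 ^ Suc k) (x, z))"
          using L by (simp add: ennreal_mult' mult_ac)
        also have "\<dots> \<le> (\<Sum>k. ennreal (4 * L) * deviation f (1 / 2 ^ Suc k) (x, z))"
          by (rule sum_le_suminf) auto
        finally show ?thesis .
      qed simp
      then show ?thesis
        by (simp add: p w_def \<tau>_def)
    qed
    have "(\<integral>\<^sup>+p. ennreal ((f (fst p))\<^sup>2 * ln (max 1 ((f (fst p))\<^sup>2
          / (T * exp (8 * \<kappa> * ((norm (fst p))\<^sup>2 + (norm (snd p))\<^sup>2)))))) \<partial>J)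
        \<le> (\<integral>\<^sup>+p. (\<Sum>k. ennreal (4 * L) * deviation f (1 / 2 ^ Suc k) p) \<partial>J)"
      by (intro nn_integral_mono pw)
    also have "\<dots> = (\<Sum>k. \<integral>\<^sup>+p. ennreal (4 * L) * deviation f (1 / 2 ^ Suc k) p \<partial>J)"
      by (rule nn_integral_suminf) simp
    also have "\<dots> = (\<Sum>k. ennreal (4 * L) * (\<integral>\<^sup>+p. deviation f (1 / 2 ^ Suc k) p \<partial>J))"
      by (simp add: nn_integral_cmult)
    also have "\<dots> \<le> (\<Sum>k. ennreal (2 * L * gauss_variance TYPE('a) \<kappa> * energy f * (1 / 2) ^ Suc k))"
    proof (intro suminf_le allI)
      fix k :: nat
      have "(1::real) / 2 ^ Suc k \<le> 1"
        using one_le_power[of "2::real" "Suc k"] by (simp add: divide_le_eq_1 del: power_Suc)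
      then have t: "1 / 2 ^ Suc k < pi"
        using pi_gt3 by linarith
      have "ennreal (4 * L) * (\<integral>\<^sup>+p. deviation f (1 / 2 ^ Suc k) p \<partial>J)
          \<le> ennreal (4 * L) * ennreal ((1 / 2 ^ Suc k)\<^sup>2 * gauss_variance TYPE('a) \<kappa> * energy f)"
        by (intro mult_left_mono nn_integral_deviation_le f t) simp_all
      also have "\<dots> = ennreal (4 * L * ((1 / 2 ^ Suc k)\<^sup>2 * gauss_variance TYPE('a) \<kappa> * energy f))"
        using L by (simp add: ennreal_mult')
      also have "\<dots> \<le> ennreal (2 * L * gauss_variance TYPE('a) \<kappa> * energy f * (1 / 2) ^ Suc k)"
      proof (rule ennreal_leI)
        have "(1 / 2 ^ Suc k :: real)\<^sup>2 = (1 / 2) ^ Suc k * (1 / 2) ^ Suc k"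
          by (simp add: power2_eq_square power_divide)
        also have "\<dots> \<le> (1 / 2) * (1 / 2) ^ Suc k"
          by (intro mult_right_mono) (auto simp: power_le_one)
        finally have "4 * L * gauss_variance TYPE('a) \<kappa> * energy f * (1 / 2 ^ Suc k)\<^sup>2 \<le> 4 * L * gauss_variance TYPE('a) \<kappa> * energy f * ((1 / 2) * (1 / 2) ^ Suc k)"
          using L S energy_nonneg[of f] by (intro mult_left_mono) auto
        then show "4 * L * ((1 / 2 ^ Suc k)\<^sup>2 * gauss_variance TYPE('a) \<kappa> * energy f) \<le> 2 * L * gauss_variance TYPE('a) \<kappa> * energy f * (1 / 2) ^ Suc k"
          by (simp add: mult_ac)
      qed
      finally show "ennreal (4 * L) * (\<integral>\<^sup>+p. deviation f (1 / 2 ^ Suc k) p \<partial>J)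
          \<le> ennreal (2 * L * gauss_variance TYPE('a) \<kappa> * energy f * (1 / 2) ^ Suc k)" .
    qed auto
    also have "\<dots> = ennreal (\<Sum>k. 2 * L * gauss_variance TYPE('a) \<kappa> * energy f * (1 / 2) ^ Suc k)"
      using L S energy_nonneg[of f] power_half_series[THEN sums_summable]
      by (intro suminf_ennreal2 summable_mult) auto
    also have "(\<Sum>k. 2 * L * gauss_variance TYPE('a) \<kappa> * energy f * (1 / 2) ^ Suc k) = 2 * L * gauss_variance TYPE('a) \<kappa> * energy f"
      using power_half_series by (subst suminf_mult) (auto simp: sums_iff)
    also have "\<dots> \<le> ennreal ((2 * L * gauss_variance TYPE('a) \<kappa> + 1) * energy f)"
      using energy_nonneg[of f] by (intro ennreal_leI) (simp add: algebra_simps)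
    finally show ?thesis .
  qed
  have "2 * L * gauss_variance TYPE('a) \<kappa> + 1 > 0"
    using L S by (intro add_nonneg_pos) auto
  then show thesis
    by (rule that[OF T(1) _ main])
qed

text \<open>
  The form \<open>ln (1 + 4 * f ^ 2)\<close> is nonnegative and at most \<open>4 * f ^ 2\<close>, so that the bound stays
  proportional to the energy and the mass of \<open>f\<close> when \<open>f\<close> is small; this is what the final
  perturbation argument needs.
\<close>

lemma defective_log_sobolev:
  obtains A B where "A > 0" "B > 0"
    "\<And>f. f \<in> Cb1 \<Longrightarrow> mass f \<le> 1 \<Longrightarrow>
      (\<integral>p. (f (fst p))\<^sup>2 * ln (1 + 4 * (f (fst p))\<^sup>2) \<partial>J) \<le> A * energy f + B * mass f"
proof -
  obtain T A where T: "T > 0" "A > 0" "\<And>f. f \<in> Cb1 \<Longrightarrow> mass f \<le> 1 \<Longrightarrow>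
      (\<integral>\<^sup>+p. ennreal ((f (fst p))\<^sup>2 * ln (max 1 ((f (fst p))\<^sup>2
          / (T * exp (8 * \<kappa> * ((norm (fst p))\<^sup>2 + (norm (snd p))\<^sup>2)))))) \<partial>J)
        \<le> ennreal (A * energy f)"
    by (rule layer_cake) (rule that)
  obtain A' B' where m: "A' > 0" "B' > 0"
    "\<And>f. f \<in> Cb1 \<Longrightarrow> (\<integral>p. (f (fst p))\<^sup>2 * ((norm (fst p))\<^sup>2 + (norm (snd p))\<^sup>2) \<partial>J)
      \<le> A' * energy f + B' * mass f"
    by (rule second_moment_control[folded energy_def mass_def]) (rule that)
  define L where "L = ln (1 + 4 * T)"
  have L: "L > 0"
    using T by (simp add: L_def)
  have main: "(\<integral>p. (f (fst p))\<^sup>2 * ln (1 + 4 * (f (fst p))\<^sup>2) \<partial>J)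
      \<le> (A + 8 * \<kappa> * A') * energy f + (L + 8 * \<kappa> * B') * mass f"
    if f: "f \<in> Cb1" and mass: "mass f \<le> 1" for f
  proof -
    note [measurable] = Cb1_measurable[OF f]
    obtain a where a: "a \<ge> 0" "\<And>x. \<bar>f x\<bar> \<le> a" "\<And>x. norm (gradient f x) \<le> a"
      by (rule Cb1_bounds[OF f]) (rule that)
    have fa: "(f x)\<^sup>2 \<le> a\<^sup>2" for x
      using a(1) a(2)[of x] by (auto simp: abs_le_square_iff[symmetric])
    let ?r = "\<lambda>p::'a \<times> 'a. (norm (fst p))\<^sup>2 + (norm (snd p))\<^sup>2"
    define \<tau> where "\<tau> p = T * exp (8 * \<kappa> * ?r p)" for p :: "'a \<times> 'a"
    have \<tau>: "\<tau> p \<ge> T" "\<tau> p > 0" for p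
      using T(1) \<kappa> by (auto simp: \<tau>_def)
    define w where "w p = max 1 ((f (fst p))\<^sup>2 / \<tau> p)" for p
    have [measurable]: "w \<in> borel_measurable (borel \<Otimes>\<^sub>M borel)"
      unfolding w_def \<tau>_def by measurable
    have w: "1 \<le> w p" for p
      by (simp add: w_def)
    have iw: "integrable J (\<lambda>p. (f (fst p))\<^sup>2 * ln (w p))"
    proof (rule integrable_J_Cb1(1)[OF f])
      have "ln (w p) \<le> ln (max 1 (a\<^sup>2 / T))" for p
      proof -
        have "(f (fst p))\<^sup>2 / \<tau> p \<le> a\<^sup>2 / T"
          using fa \<tau> T by (intro frac_le) auto
        then have "w p \<le> max 1 (a\<^sup>2 / T)"
          unfolding w_def by (rule max.mono[OF order_refl])
        then show ?thesis
          using w[of p] by (subst ln_le_cancel_iff) auto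
      qed
      then show "integrable J (\<lambda>p. ln (w p))"
        using w by (intro J.integrable_const_bound[where B = "ln (max 1 (a\<^sup>2 / T))"]) (auto intro!: AE_I2)
    qed
    have ir: "integrable J (\<lambda>p. (f (fst p))\<^sup>2 * ?r p)"
      by (rule integrable_J_Cb1(1)[OF f]) (use integrable_J_fst integrable_J_snd in simp)
    have i1: "integrable J (\<lambda>p. (f (fst p))\<^sup>2)"
      by (rule integrable_J_Cb1'(1)[OF f])
    have pw: "ln (1 + 4 * (f (fst p))\<^sup>2) \<le> ln (w p) + L + 8 * \<kappa> * ?r p" for p
    proof -
      have e1: "1 \<le> exp (8 * \<kappa> * ?r p)"
        using \<kappa> by simp
      have "(f (fst p))\<^sup>2 \<le> w p * \<tau> p"
      proof -
        have "(f (fst p))\<^sup>2 / \<tau> p \<le> w p"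
          by (simp add: w_def)
        then show ?thesis
          using \<tau>(2)[of p] by (simp add: field_simps)
      qed
      moreover have "1 \<le> w p * exp (8 * \<kappa> * ?r p)"
        using mult_mono[OF w[of p] e1] w[of p] by simp
      ultimately have "1 + 4 * (f (fst p))\<^sup>2 \<le> w p * (1 + 4 * T) * exp (8 * \<kappa> * ?r p)"
        by (simp add: \<tau>_def algebra_simps)
      then have "ln (1 + 4 * (f (fst p))\<^sup>2) \<le> ln (w p * (1 + 4 * T) * exp (8 * \<kappa> * ?r p))"
        using w[of p] T(1) by (subst ln_le_cancel_iff) (auto intro!: mult_pos_pos add_pos_nonneg)
      also have "\<dots> = ln (w p) + L + 8 * \<kappa> * ?r p"
        using w[of p] T(1) by (simp add: ln_mult L_def)
      finally show ?thesis .
    qed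
    have "(\<integral>p. (f (fst p))\<^sup>2 * ln (1 + 4 * (f (fst p))\<^sup>2) \<partial>J)
        \<le> (\<integral>p. (f (fst p))\<^sup>2 * ln (w p) + L * (f (fst p))\<^sup>2 + 8 * \<kappa> * ((f (fst p))\<^sup>2 * ?r p) \<partial>J)"
    proof (rule integral_mono')
      show "integrable J (\<lambda>p. (f (fst p))\<^sup>2 * ln (w p) + L * (f (fst p))\<^sup>2 + 8 * \<kappa> * ((f (fst p))\<^sup>2 * ?r p))"
        by (intro Bochner_Integration.integrable_add integrable_mult_right iw ir i1)
      fix p
      show "(f (fst p))\<^sup>2 * ln (1 + 4 * (f (fst p))\<^sup>2)
          \<le> (f (fst p))\<^sup>2 * ln (w p) + L * (f (fst p))\<^sup>2 + 8 * \<kappa> * ((f (fst p))\<^sup>2 * ?r p)"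
        using mult_left_mono[OF pw[of p], of "(f (fst p))\<^sup>2"] by (simp add: algebra_simps)
      show "0 \<le> (f (fst p))\<^sup>2 * ln (w p) + L * (f (fst p))\<^sup>2 + 8 * \<kappa> * ((f (fst p))\<^sup>2 * ?r p)"
        using w[of p] L \<kappa> by (intro add_nonneg_nonneg mult_nonneg_nonneg) auto
    qed
    also have "\<dots> = (\<integral>p. (f (fst p))\<^sup>2 * ln (w p) \<partial>J) + L * mass f + 8 * \<kappa> * (\<integral>p. (f (fst p))\<^sup>2 * ?r p \<partial>J)"
      using iw ir i1 by (simp add: mass_def)
    also have "\<dots> \<le> A * energy f + L * mass f + 8 * \<kappa> * (A' * energy f + B' * mass f)"
    proof (intro add_mono mult_left_mono m(3) f order_refl)
      have "ennreal (\<integral>p. (f (fst p))\<^sup>2 * ln (w p) \<partial>J) = (\<integral>\<^sup>+p. ennreal ((f (fst p))\<^sup>2 * ln (w p)) \<partial>J)"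
        using w by (intro nn_integral_eq_integral[symmetric] iw AE_I2) auto
      also have "\<dots> \<le> ennreal (A * energy f)"
        using T(3)[OF f mass] by (simp add: w_def \<tau>_def)
      finally show "(\<integral>p. (f (fst p))\<^sup>2 * ln (w p) \<partial>J) \<le> A * energy f"
        using T(2) energy_nonneg[of f] by (subst (asm) ennreal_le_iff) auto
    qed (use \<kappa> L in auto)
    finally show ?thesis
      by (simp add: algebra_simps)
  qed
  show thesis
    by (rule that[OF _ _ main]) (use T m L \<kappa> in \<open>auto intro!: add_pos_pos\<close>)
qed

section \<open>Poincare inequality\<close>

text \<open>
  Two independent Gaussian vectors are interchanged by a rotation by \<open>pi / 2\<close>, so the rotation energy
  bounds the mean of \<open>(f x - f y) ^ 2\<close> over independent pairs.  The Gaussian of parameter \<open>2 * \<kappa>\<close> has the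
  advantage that its density is at most a multiple of that of \<open>X\<close>, so its energy is bounded by \<open>energy f\<close>.
\<close>

lemma local_poincare:
  obtains K where "K > 0"
    "\<And>f. f \<in> Cb1 \<Longrightarrow> \<exists>c. (\<integral>\<^sup>+x. ennreal ((f x - c)\<^sup>2) \<partial>gauss (2 * \<kappa>)) \<le> ennreal (K * energy f)"
proof -
  have \<kappa>2: "2 * \<kappa> > 0"
    using \<kappa> by simp
  interpret G2: prob_space "gauss (2 * \<kappa>) :: 'a measure"
    by (rule prob_space_gauss[OF \<kappa>2])
  obtain c where c: "c > 0" "\<And>x. c * exp (- ((1 + 1) * \<kappa> * (norm x)\<^sup>2)) \<le> q x"
    by (rule q_lower_bound[of 1]) auto
  let ?g = "gauss_const TYPE('a) \<kappa>" and ?g2 = "gauss_const TYPE('a) (2 * \<kappa>)"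
  have g: "?g > 0" "?g2 > 0"
    using gauss_const_pos[OF \<kappa>] gauss_const_pos[OF \<kappa>2] by auto
  define R where "R = ?g2 / (c * ?g)"
  have R: "R > 0"
    using c g by (simp add: R_def)
  define S2 where "S2 = gauss_variance TYPE('a) (2 * \<kappa>)"
  have S2: "S2 \<ge> 0"
    by (simp add: S2_def gauss_variance_def)
  have [measurable]: "q \<in> borel_measurable borel"
    unfolding q_def by measurable
  have main: "\<exists>c. (\<integral>\<^sup>+x. ennreal ((f x - c)\<^sup>2) \<partial>gauss (2 * \<kappa>)) \<le> ennreal (((pi / 2)\<^sup>2 * R * S2 + 1) * energy f)"
    if f: "f \<in> Cb1" for f
  proof -
    note [measurable] = Cb1_measurable[OF f] Cb1_measurable_gradient[OF f]
    have S2_eq: "(\<integral>\<^sup>+y. ennreal ((norm y)\<^sup>2) \<partial>(gauss (2 * \<kappa>) :: 'a measure)) = ennreal S2"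
      unfolding S2_def gauss_variance_def using integrable_gauss_norm_sq[OF \<kappa>2] by (intro nn_integral_eq_integral) auto
    have "(\<integral>\<^sup>+x. ennreal ((norm (gradient f x))\<^sup>2) \<partial>gauss (2 * \<kappa>))
        = (\<integral>\<^sup>+x. ennreal (?g2 * exp (- (2 * \<kappa> * (norm x)\<^sup>2))) * ennreal ((norm (gradient f x))\<^sup>2) \<partial>lborel)"
      by (subst nn_integral_gauss) simp_all
    also have "\<dots> \<le> (\<integral>\<^sup>+x. ennreal R * (ennreal (?g * q x) * ennreal ((norm (gradient f x))\<^sup>2)) \<partial>lborel)"
    proof (rule nn_integral_mono)
      fix x
      have "?g2 * exp (- (2 * \<kappa> * (norm x)\<^sup>2)) \<le> ?g2 * (q x / c)"
        using c(1) c(2)[of x] g by (intro mult_left_mono) (auto simp: field_simps)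
      also have "\<dots> = R * (?g * q x)"
        using g by (simp add: R_def)
      finally have "ennreal (?g2 * exp (- (2 * \<kappa> * (norm x)\<^sup>2))) \<le> ennreal R * ennreal (?g * q x)"
        using R by (simp add: ennreal_mult'[symmetric] ennreal_leI)
      then show "ennreal (?g2 * exp (- (2 * \<kappa> * (norm x)\<^sup>2))) * ennreal ((norm (gradient f x))\<^sup>2)
          \<le> ennreal R * (ennreal (?g * q x) * ennreal ((norm (gradient f x))\<^sup>2))"
        unfolding mult.assoc[symmetric] by (rule mult_right_mono) simp
    qed
    also have "\<dots> = ennreal R * ennreal (energy f)"
      using nn_integral_J_fst[of "\<lambda>x. ennreal ((norm (gradient f x))\<^sup>2)"]
      by (simp add: nn_integral_cmult nn_integral_energy[OF f])
    finally have D2: "(\<integral>\<^sup>+x. ennreal ((norm (gradient f x))\<^sup>2) \<partial>gauss (2 * \<kappa>)) \<le> ennreal (R * energy f)"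
      using R by (simp add: ennreal_mult')
    have "(\<integral>\<^sup>+y. \<integral>\<^sup>+x. ennreal ((f x - f y)\<^sup>2) \<partial>gauss (2 * \<kappa>) \<partial>gauss (2 * \<kappa>))
        = (\<integral>\<^sup>+x. \<integral>\<^sup>+y. ennreal ((f x - f (cos (pi / 2) *\<^sub>R x + sin (pi / 2) *\<^sub>R y))\<^sup>2) \<partial>gauss (2 * \<kappa>) \<partial>gauss (2 * \<kappa>))"
      by (simp add: power2_commute)
    also have "\<dots> \<le> ennreal ((pi / 2)\<^sup>2) * ((\<integral>\<^sup>+x. ennreal ((norm (gradient f x))\<^sup>2) \<partial>gauss (2 * \<kappa>)) * ennreal S2)"
      using gauss_rotation_energy[OF f \<kappa>2, of "pi / 2"] by (simp only: S2_eq) simp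
    also have "\<dots> \<le> ennreal ((pi / 2)\<^sup>2) * (ennreal (R * energy f) * ennreal S2)"
      by (intro mult_left_mono mult_right_mono D2) auto
    also have "\<dots> = ennreal ((pi / 2)\<^sup>2 * R * S2 * energy f)"
      using R S2 energy_nonneg[of f] by (simp add: ennreal_mult[symmetric] mult_ac)
    also have "\<dots> \<le> ennreal (((pi / 2)\<^sup>2 * R * S2 + 1) * energy f)"
      using energy_nonneg[of f] by (intro ennreal_leI) (simp add: algebra_simps)
    finally have le: "(\<integral>\<^sup>+y. \<integral>\<^sup>+x. ennreal ((f x - f y)\<^sup>2) \<partial>gauss (2 * \<kappa>) \<partial>gauss (2 * \<kappa>))
        \<le> ennreal (((pi / 2)\<^sup>2 * R * S2 + 1) * energy f)" .
    obtain y where "(\<integral>\<^sup>+x. ennreal ((f x - f y)\<^sup>2) \<partial>gauss (2 * \<kappa>))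
        \<le> (\<integral>\<^sup>+y. \<integral>\<^sup>+x. ennreal ((f x - f y)\<^sup>2) \<partial>gauss (2 * \<kappa>) \<partial>gauss (2 * \<kappa>))"
    proof (rule G2.nn_integral_attains_le)
      show "(\<lambda>y. \<integral>\<^sup>+x. ennreal ((f x - f y)\<^sup>2) \<partial>gauss (2 * \<kappa>)) \<in> borel_measurable (gauss (2 * \<kappa>))"
        by measurable
      show "(\<integral>\<^sup>+y. \<integral>\<^sup>+x. ennreal ((f x - f y)\<^sup>2) \<partial>gauss (2 * \<kappa>) \<partial>gauss (2 * \<kappa>)) < \<infinity>"
        using le_less_trans[OF le ennreal_less_top] by simp
    qed
    from order_trans[OF this le] show ?thesis ..
  qed
  have "0 < (pi / 2)\<^sup>2 * R * S2 + 1"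
    using R S2 by (intro add_nonneg_pos) auto
  then show thesis
    by (rule that[OF _ main])
qed

text \<open>
  On the ball \<open>norm x ^ 2 \<le> 2 * B\<close> the mixture is dominated by the Gaussian of the local inequality.
  Outside it, Chebyshev's inequality and the moment bound contribute at most half of the mass, which
  is absorbed; this determines the radius.
\<close>

lemma poincare:
  obtains K where "K > 0" "\<And>f. f \<in> Cb1 \<Longrightarrow> \<exists>c. mass (\<lambda>x. f x - c) \<le> K * energy f"
proof -
  obtain A B where AB: "A > 0" "B > 0"
    "\<And>f. f \<in> Cb1 \<Longrightarrow> (\<integral>p. (f (fst p))\<^sup>2 * ((norm (fst p))\<^sup>2 + (norm (snd p))\<^sup>2) \<partial>J)
      \<le> A * energy f + B * mass f"
    by (rule second_moment_control[folded energy_def mass_def]) (rule that)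
  obtain K where K: "K > 0"
    "\<And>f. f \<in> Cb1 \<Longrightarrow> \<exists>c. (\<integral>\<^sup>+x. ennreal ((f x - c)\<^sup>2) \<partial>gauss (2 * \<kappa>)) \<le> ennreal (K * energy f)"
    by (rule local_poincare) (rule that)
  have \<kappa>2: "2 * \<kappa> > 0"
    using \<kappa> by simp
  let ?g = "gauss_const TYPE('a) \<kappa>" and ?g2 = "gauss_const TYPE('a) (2 * \<kappa>)"
  have g: "?g > 0" "?g2 > 0"
    using gauss_const_pos[OF \<kappa>] gauss_const_pos[OF \<kappa>2] by auto
  define Q where "Q = ?g / ?g2 * exp (2 * \<kappa> * (2 * B))"
  have Q: "Q > 0"
    using g by (simp add: Q_def)
  have [measurable]: "q \<in> borel_measurable borel"
    unfolding q_def by measurable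
  have main: "\<exists>c. mass (\<lambda>x. f x - c) \<le> (2 * Q * K + A / B) * energy f" if f: "f \<in> Cb1" for f
  proof -
    obtain c where c: "(\<integral>\<^sup>+x. ennreal ((f x - c)\<^sup>2) \<partial>gauss (2 * \<kappa>)) \<le> ennreal (K * energy f)"
      using K(2)[OF f] ..
    define h where "h = (\<lambda>x. f x - c)"
    have h: "h \<in> Cb1" and energy_h: "energy h = energy f"
      using Cb1_diff_const[OF f, of c] by (simp_all add: h_def energy_def)
    note [measurable] = Cb1_measurable[OF h]
    define b :: "'a \<Rightarrow> real" where "b x = indicator {x. (norm x)\<^sup>2 \<le> 2 * B} x" for x
    have [measurable]: "b \<in> borel_measurable borel"
      unfolding b_def by measurable
    have b: "0 \<le> b x" "b x \<le> 1" for x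
      by (auto simp: b_def indicator_def)
    have i1: "integrable J (\<lambda>p. (h (fst p))\<^sup>2)"
      by (rule integrable_J_Cb1'(1)[OF h])
    have ib: "integrable J (\<lambda>p. (h (fst p))\<^sup>2 * b (fst p))"
      using b by (intro integrable_J_Cb1(1)[OF h] J.integrable_const_bound[where B = 1]) (auto intro!: AE_I2)
    have ir: "integrable J (\<lambda>p. (h (fst p))\<^sup>2 * ((norm (fst p))\<^sup>2 + (norm (snd p))\<^sup>2))"
      by (rule integrable_J_Cb1(1)[OF h]) (use integrable_J_fst integrable_J_snd in simp)
    define I where "I = (\<integral>p. (h (fst p))\<^sup>2 * b (fst p) \<partial>J)"
    have "ennreal I = (\<integral>\<^sup>+p. ennreal ((h (fst p))\<^sup>2 * b (fst p)) \<partial>J)"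
      unfolding I_def using b by (intro nn_integral_eq_integral[symmetric] ib AE_I2) auto
    also have "\<dots> = (\<integral>\<^sup>+x. ennreal (?g * q x) * ennreal ((h x)\<^sup>2 * b x) \<partial>lborel)"
      by (rule nn_integral_J_fst) measurable
    also have "\<dots> \<le> (\<integral>\<^sup>+x. ennreal Q * (ennreal (?g2 * exp (- (2 * \<kappa> * (norm x)\<^sup>2))) * ennreal ((h x)\<^sup>2)) \<partial>lborel)"
    proof (rule nn_integral_mono)
      fix x
      have "q x * b x \<le> exp (2 * \<kappa> * (2 * B)) * exp (- (2 * \<kappa> * (norm x)\<^sup>2))"
      proof (cases "(norm x)\<^sup>2 \<le> 2 * B")
        case True
        then have "2 * \<kappa> * (norm x)\<^sup>2 \<le> 2 * \<kappa> * (2 * B)"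
          using \<kappa> by (intro mult_left_mono) auto
        then have "1 \<le> exp (2 * \<kappa> * (2 * B)) * exp (- (2 * \<kappa> * (norm x)\<^sup>2))"
          by (simp add: exp_add[symmetric])
        then show ?thesis
          using True q_le_1[of x] by (simp add: b_def)
      qed (simp add: b_def)
      then have "?g * (h x)\<^sup>2 * (q x * b x) \<le> ?g * (h x)\<^sup>2 * (exp (2 * \<kappa> * (2 * B)) * exp (- (2 * \<kappa> * (norm x)\<^sup>2)))"
        using g by (intro mult_left_mono) auto
      also have "\<dots> = Q * (?g2 * exp (- (2 * \<kappa> * (norm x)\<^sup>2)) * (h x)\<^sup>2)"
        using g by (simp add: Q_def)
      finally have "ennreal (?g * (h x)\<^sup>2 * (q x * b x)) \<le> ennreal (Q * (?g2 * exp (- (2 * \<kappa> * (norm x)\<^sup>2)) * (h x)\<^sup>2))"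
        by (rule ennreal_leI)
      then show "ennreal (?g * q x) * ennreal ((h x)\<^sup>2 * b x)
          \<le> ennreal Q * (ennreal (?g2 * exp (- (2 * \<kappa> * (norm x)\<^sup>2))) * ennreal ((h x)\<^sup>2))"
        using g Q b[of x] q_pos[of x] by (simp add: ennreal_mult[symmetric] mult_ac)
    qed
    also have "\<dots> = ennreal Q * (\<integral>\<^sup>+x. ennreal ((h x)\<^sup>2) \<partial>gauss (2 * \<kappa>))"
      by (simp add: nn_integral_cmult nn_integral_gauss)
    also have "\<dots> \<le> ennreal Q * ennreal (K * energy f)"
      using c by (intro mult_left_mono) (auto simp: h_def)
    also have "\<dots> = ennreal (Q * (K * energy f))"
      using Q by (simp add: ennreal_mult')
    finally have I: "I \<le> Q * (K * energy f)"
      using Q K(1) energy_nonneg[of f] by (subst (asm) ennreal_le_iff) auto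
    have "mass h \<le> (\<integral>p. (h (fst p))\<^sup>2 * b (fst p) + 1 / (2 * B) * ((h (fst p))\<^sup>2 * ((norm (fst p))\<^sup>2 + (norm (snd p))\<^sup>2)) \<partial>J)"
      unfolding mass_def
    proof (intro integral_mono i1 Bochner_Integration.integrable_add integrable_mult_right ib ir)
      fix p :: "'a \<times> 'a"
      have "1 \<le> b (fst p) + 1 / (2 * B) * ((norm (fst p))\<^sup>2 + (norm (snd p))\<^sup>2)"
      proof (cases "(norm (fst p))\<^sup>2 \<le> 2 * B")
        case True
        then show ?thesis
          using AB by (simp add: b_def)
      next
        case False
        then have "2 * B \<le> (norm (fst p))\<^sup>2 + (norm (snd p))\<^sup>2"
          using zero_le_power2[of "norm (snd p)"] by linarith
        then show ?thesis
          using AB False by (simp add: b_def field_simps)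
      qed
      from mult_left_mono[OF this, of "(h (fst p))\<^sup>2"]
      show "(h (fst p))\<^sup>2 \<le> (h (fst p))\<^sup>2 * b (fst p) + 1 / (2 * B) * ((h (fst p))\<^sup>2 * ((norm (fst p))\<^sup>2 + (norm (snd p))\<^sup>2))"
        by (simp add: distrib_left mult_ac)
    qed
    also have "\<dots> = I + 1 / (2 * B) * (\<integral>p. (h (fst p))\<^sup>2 * ((norm (fst p))\<^sup>2 + (norm (snd p))\<^sup>2) \<partial>J)"
      unfolding I_def using ib ir by (subst Bochner_Integration.integral_add) auto
    also have "\<dots> \<le> Q * (K * energy f) + 1 / (2 * B) * (A * energy f + B * mass h)"
      using AB(3)[OF h] AB(2) I by (intro add_mono mult_left_mono) (auto simp: energy_h)
    also have "\<dots> = Q * K * energy f + A / B * energy f / 2 + mass h / 2"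
      using AB(2) by (simp add: field_simps)
    finally have "mass h \<le> (2 * Q * K + A / B) * energy f"
      by (simp add: distrib_right)
    then show ?thesis
      unfolding h_def ..
  qed
  have "0 < 2 * Q * K + A / B"
    using Q K AB by (intro add_pos_pos) auto
  then show thesis
    by (rule that[OF _ main])
qed

section \<open>Tightening\<close>

text \<open>
  The two cases \<open>4 * K * energy f \<ge> 1\<close> and \<open>4 * K * energy f < 1\<close> correspond to \<open>f\<close> far from and close
  to a constant.  In the second case the Poincare inequality gives \<open>mass (f - c) \<le> 1 / 4\<close>, which forces
  \<open>c ^ 2 \<ge> 1 / 4\<close>.
\<close>

lemma log_sobolev:
  "\<exists>C>0. \<forall>f\<in>Cb1. mass f = 1 \<longrightarrow> (\<integral>p. (f (fst p))\<^sup>2 * ln ((f (fst p))\<^sup>2) \<partial>J) \<le> C * energy f"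
proof -
  obtain A B where AB: "A > 0" "B > 0" "\<And>f. f \<in> Cb1 \<Longrightarrow> mass f \<le> 1 \<Longrightarrow>
      (\<integral>p. (f (fst p))\<^sup>2 * ln (1 + 4 * (f (fst p))\<^sup>2) \<partial>J) \<le> A * energy f + B * mass f"
    by (rule defective_log_sobolev) (rule that)
  obtain K where K: "K > 0" "\<And>f. f \<in> Cb1 \<Longrightarrow> \<exists>c. mass (\<lambda>x. f x - c) \<le> K * energy f"
    by (rule poincare) (rule that)
  have iln: "integrable J (\<lambda>p. (f (fst p))\<^sup>2 * ln (1 + 4 * (f (fst p))\<^sup>2))"
    and iln': "integrable J (\<lambda>p. (f (fst p))\<^sup>2 * ln ((f (fst p))\<^sup>2))" if f: "f \<in> Cb1" for f
  proof -
    note [measurable] = Cb1_measurable[OF f]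
    obtain a where a: "a \<ge> 0" "\<And>x. \<bar>f x\<bar> \<le> a" "\<And>x. norm (gradient f x) \<le> a"
      by (rule Cb1_bounds[OF f]) (rule that)
    have fa: "(f x)\<^sup>2 \<le> a\<^sup>2" for x
      using a(1) a(2)[of x] by (auto simp: abs_le_square_iff[symmetric])
    have "ln (1 + 4 * (f x)\<^sup>2) \<le> ln (1 + 4 * a\<^sup>2)" for x
      using fa[of x] by (subst ln_le_cancel_iff) (auto simp: add_pos_nonneg)
    then show "integrable J (\<lambda>p. (f (fst p))\<^sup>2 * ln (1 + 4 * (f (fst p))\<^sup>2))"
      by (intro integrable_J_Cb1(1)[OF f] J.integrable_const_bound[where B = "ln (1 + 4 * a\<^sup>2)"]) (auto intro!: AE_I2)
    have "\<bar>(f x)\<^sup>2 * ln ((f x)\<^sup>2)\<bar> \<le> 1 + (a\<^sup>2)\<^sup>2" for x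
      using abs_mult_ln_le[of "(f x)\<^sup>2"] power_mono[OF fa[of x], of 2] by simp
    then show "integrable J (\<lambda>p. (f (fst p))\<^sup>2 * ln ((f (fst p))\<^sup>2))"
      by (intro J.integrable_const_bound[where B = "1 + (a\<^sup>2)\<^sup>2"]) (auto intro!: AE_I2)
  qed
  define C where "C = max (A + 4 * K * B) (9 * K + 4 * (A + B * K))"
  have "C > 0"
    using AB K by (auto simp: C_def less_max_iff_disj intro!: add_pos_pos)
  moreover have "(\<integral>p. (f (fst p))\<^sup>2 * ln ((f (fst p))\<^sup>2) \<partial>J) \<le> C * energy f"
    if f: "f \<in> Cb1" and mass: "mass f = 1" for f
  proof (cases "1 \<le> 4 * K * energy f")
    case True
    have "(\<integral>p. (f (fst p))\<^sup>2 * ln ((f (fst p))\<^sup>2) \<partial>J) \<le> (\<integral>p. (f (fst p))\<^sup>2 * ln (1 + 4 * (f (fst p))\<^sup>2) \<partial>J)"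
    proof (intro integral_mono iln iln' f)
      fix p
      show "(f (fst p))\<^sup>2 * ln ((f (fst p))\<^sup>2) \<le> (f (fst p))\<^sup>2 * ln (1 + 4 * (f (fst p))\<^sup>2)"
      proof (cases "f (fst p) = 0")
        case False
        then show ?thesis
          by (intro mult_left_mono) (auto simp: add_pos_nonneg)
      qed simp
    qed
    also have "\<dots> \<le> A * energy f + B"
      using AB(3)[OF f] mass by simp
    also have "\<dots> \<le> A * energy f + B * (4 * K * energy f)"
      using mult_left_mono[OF True, of B] AB(2) by simp
    also have "\<dots> = (A + 4 * K * B) * energy f"
      by (simp add: algebra_simps)
    also have "\<dots> \<le> C * energy f"
      using energy_nonneg[of f] by (intro mult_right_mono) (simp_all add: C_def)
    finally show ?thesis .
  next
    case False
    obtain c where c: "mass (\<lambda>x. f x - c) \<le> K * energy f"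
      using K(2)[OF f] ..
    define g where "g = (\<lambda>x. f x - c)"
    have g: "g \<in> Cb1" and energy_g: "energy g = energy f"
      using Cb1_diff_const[OF f, of c] by (simp_all add: g_def energy_def)
    have mass_g: "mass g \<le> K * energy f" "mass g \<le> 1 / 4"
      using c False by (auto simp: g_def)
    have i_f: "integrable J (\<lambda>p. (f (fst p))\<^sup>2)" and i_g: "integrable J (\<lambda>p. (g (fst p))\<^sup>2)"
      using integrable_J_Cb1'(1) f g by auto
    have c4: "c\<^sup>2 \<ge> 1 / 4"
    proof -
      have "mass f \<le> (\<integral>p. 2 * c\<^sup>2 + 2 * (g (fst p))\<^sup>2 \<partial>J)"
        unfolding mass_def
      proof (rule integral_mono[OF i_f])
        show "integrable J (\<lambda>p. 2 * c\<^sup>2 + 2 * (g (fst p))\<^sup>2)"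
          using i_g by simp
        fix p :: "'a \<times> 'a"
        show "(f (fst p))\<^sup>2 \<le> 2 * c\<^sup>2 + 2 * (g (fst p))\<^sup>2"
          using zero_le_power2[of "f (fst p) - 2 * c"] by (simp add: g_def power2_eq_square algebra_simps)
      qed
      also have "\<dots> = 2 * c\<^sup>2 + 2 * mass g"
        using i_g J.prob_space by (simp add: mass_def)
      finally show ?thesis
        using mass mass_g by simp
    qed
    have "(\<integral>p. (f (fst p))\<^sup>2 * ln ((f (fst p))\<^sup>2) \<partial>J)
        \<le> (\<integral>p. 9 * (g (fst p))\<^sup>2 + 4 * ((g (fst p))\<^sup>2 * ln (1 + 4 * (g (fst p))\<^sup>2)) + (f (fst p))\<^sup>2 * (1 + ln (c\<^sup>2)) - c\<^sup>2 \<partial>J)"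
    proof (rule integral_mono[OF iln'[OF f]])
      show "integrable J (\<lambda>p. 9 * (g (fst p))\<^sup>2 + 4 * ((g (fst p))\<^sup>2 * ln (1 + 4 * (g (fst p))\<^sup>2)) + (f (fst p))\<^sup>2 * (1 + ln (c\<^sup>2)) - c\<^sup>2)"
        by (intro Bochner_Integration.integrable_add Bochner_Integration.integrable_diff integrable_mult_right
            integrable_mult_left i_f i_g iln g J.integrable_const)
    qed (unfold g_def, rule entropy_perturbation[OF c4])
    also have "\<dots> = 9 * mass g + 4 * (\<integral>p. (g (fst p))\<^sup>2 * ln (1 + 4 * (g (fst p))\<^sup>2) \<partial>J) + (1 + ln (c\<^sup>2)) - c\<^sup>2"
      using i_f i_g iln[OF g] J.prob_space mass by (simp add: mass_def)
    also have "\<dots> \<le> 9 * mass g + 4 * (A * energy f + B * mass g)"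
    proof -
      have "ln (c\<^sup>2) \<le> c\<^sup>2 - 1"
        by (rule ln_le_minus_one) (use c4 in linarith)
      moreover have "(\<integral>p. (g (fst p))\<^sup>2 * ln (1 + 4 * (g (fst p))\<^sup>2) \<partial>J) \<le> A * energy f + B * mass g"
        using AB(3)[OF g] mass_g(2) by (simp add: energy_g)
      then have "4 * (\<integral>p. (g (fst p))\<^sup>2 * ln (1 + 4 * (g (fst p))\<^sup>2) \<partial>J) \<le> 4 * (A * energy f + B * mass g)"
        by (intro mult_left_mono) auto
      ultimately show ?thesis
        by simp
    qed
    also have "\<dots> \<le> 9 * (K * energy f) + 4 * (A * energy f + B * (K * energy f))"
      using mass_g(1) AB by (intro add_mono mult_left_mono) auto
    also have "\<dots> = (9 * K + 4 * (A + B * K)) * energy f"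
      by (simp add: algebra_simps)
    also have "\<dots> \<le> C * energy f"
      using energy_nonneg[of f] by (intro mult_right_mono) (simp_all add: C_def)
    finally show ?thesis .
  qed
  ultimately show ?thesis
    by blast
qed

end

theorem theorem1p2:
  fixes lam :: real
    and V :: "real ^ 'd \<Rightarrow> real"
    and \<mu> \<nu> :: "(real ^ 'd) measure"
  assumes lam: "lam > 0"
    and V: "V = (\<lambda>x. lam * (norm x)\<^sup>2)"
    and \<mu>: "\<mu> = gibbs_measure V"
    and \<nu>: "prob_space \<nu>" "sets \<nu> = sets borel"
    and moment: "\<exists>\<theta>>1. (\<integral>\<^sup>+ z. ennreal (exp (lam * \<theta> * (norm z)\<^sup>2)) \<partial>\<nu>) < \<infinity>"
  shows "\<exists>C>0. \<forall>f\<in>Cb1. (\<integral>x. (f x)\<^sup>2 \<partial>(\<mu> \<star> \<nu>)) = 1 \<longrightarrow>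
           (\<integral>x. (f x)\<^sup>2 * ln ((f x)\<^sup>2) \<partial>(\<mu> \<star> \<nu>))
             \<le> C * (\<integral>x. (norm (gradient f x))\<^sup>2 \<partial>(\<mu> \<star> \<nu>))"
proof -
  obtain \<theta> where \<theta>: "\<theta> > 1" "(\<integral>\<^sup>+ z. ennreal (exp (lam * \<theta> * (norm z)\<^sup>2)) \<partial>\<nu>) < \<infinity>"
    using moment by blast
  interpret gaussian_mixture lam \<theta> \<nu>
    by (rule gaussian_mixture.intro[OF lam \<theta>(1) \<nu> \<theta>(2)])
  have \<mu>_eq: "\<mu> = gauss lam"
    by (simp add: \<mu> V)
  have "(\<mu> \<star> \<nu>) = (\<nu> \<star> \<mu>)"
    unfolding \<mu>_eq
    by (rule convolution_commutative) (simp_all add: G.finite_measure_axioms N.finite_measure_axioms)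
  also have "\<dots> = distr J borel fst"
    unfolding convolution_def J_def \<mu>_eq
    by (subst distr_distr) (auto simp: comp_def case_prod_beta' add.commute)
  finally have conv: "(\<mu> \<star> \<nu>) = distr J borel fst" .
  have transfer: "(\<integral>x. h x \<partial>(\<mu> \<star> \<nu>)) = (\<integral>p. h (fst p) \<partial>J)"
    if "h \<in> borel_measurable borel" for h :: "real ^ 'd \<Rightarrow> real"
    unfolding conv using that by (intro integral_distr) auto
  obtain C where C: "C > 0"
    "\<And>f. f \<in> Cb1 \<Longrightarrow> mass f = 1 \<Longrightarrow> (\<integral>p. (f (fst p))\<^sup>2 * ln ((f (fst p))\<^sup>2) \<partial>J) \<le> C * energy f"
    using log_sobolev by blast
  show ?thesis
  proof (intro exI conjI ballI impI)
    fix f :: "real ^ 'd \<Rightarrow> real"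
    assume f: "f \<in> Cb1" and one: "(\<integral>x. (f x)\<^sup>2 \<partial>(\<mu> \<star> \<nu>)) = 1"
    note [measurable] = Cb1_measurable[OF f] Cb1_measurable_gradient[OF f]
    have "mass f = 1"
      using one by (simp add: transfer mass_def)
    then show "(\<integral>x. (f x)\<^sup>2 * ln ((f x)\<^sup>2) \<partial>(\<mu> \<star> \<nu>)) \<le> C * (\<integral>x. (norm (gradient f x))\<^sup>2 \<partial>(\<mu> \<star> \<nu>))"
      using C(2)[OF f] by (simp add: transfer energy_def)
  qed (rule C(1))
qed

end
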